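(* Let $\boldsymbol n=(n_1,n_2)$, $\boldsymbol m=(m_1,m_2)$ be vectors of nonnegative integers with $n_1+n_2=m_1+m_2$. Let $V=\langle x^{\lambda_1}p_1(x),x^{\lambda_2}p_2(x)\rangle$, where $(V,\boldsymbol z)$ is a space of quasi-polynomials of the $(\boldsymbol n,\boldsymbol\lambda,\boldsymbol m,\boldsymbol z)$-type, $\boldsymbol\lambda=(\lambda_1,\lambda_2)$, $\boldsymbol z=(z_1,z_2)$. Let $U=\langle z_1^uq_1(u),z_2^uq_2(u)\rangle$, where $(U,\boldsymbol\lambda+\boldsymbol 1)$, $\boldsymbol1=(1,1)$, is the special bispectral dual space to $(V,\boldsymbol z)$, of the $(\boldsymbol m,\boldsymbol z,\boldsymbol n,\boldsymbol\lambda+\boldsymbol1)$-type. Write $$p_2(x)=\sum_{i=0}^{n_2}c_i\,\frac{(x-z_1)^{n_2-i}}{(n_2-i)!}\,\frac{(x-z_2)^i}{i!},\qquad p_1(x)=\sum_{i=0}^{n_1}d_i\,\frac{(x-z_1)^{n_1-i}}{(n_1-i)!}\,\frac{(x-z_2)^i}{i!},$$ $$q_2(u)=\sum_{i=0}^{m_2}\frac{e_i}{(m_2-i)!\,i!}\prod_{j=0}^{m_2-i-1}(u-\lambda_1-1-n_1+j)\prod_{j=0}^{i-1}(u-\lambda_2-1-j),$$ $$q_1(u)=\sum_{i=0}^{m_1}\frac{f_i}{(m_1-i)!\,i!}\prod_{j=0}^{m_1-i-1}(u-\lambda_1-1-n_1+j)\prod_{j=0}^{i-1}(u-\lambda_2-1-j).$$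 Set $\alpha=\max(0,n_2-m_1)$ and $\beta=\min(m_2,n_2)$. Then there exist nonzero numbers $A,B,C$ such that $$c_i=A\,d_{m_2-i}\,(z_1/z_2)^i=B\,e_i=C\,f_{n_2-i}$$ for all $i$ with $\alpha\le i\le\beta$.
   Context: **Special spaces of quasi-polynomials ($N=M=2$).** Let $\lambda_1,\lambda_2\in\mathbb C$ with $\lambda_1-\lambda_2\notin\mathbb Z$, $z_1\neq z_2$ nonzero complex numbers. Let $p_i\in\mathbb C[x]$ have degree $n_i$ with $p_i(0)\ne0$, $i=1,2$, and let $V$ be the 2-dimensional span of the multivalued functions $x^{\lambda_1}p_1,x^{\lambda_2}p_2$. The exponents of $V$ at $z\in\mathbb C^*$ are the two possible multiplicities $e_1<e_2$ at $z$ of roots of nonzero elements of $V$; $z$ is singular if $\{e_1,e_2\}\ne\{0,1\}$. $(V,\boldsymbol z)$ is of the $(\boldsymbol n,\boldsymbol\lambda,\boldsymbol m,\boldsymbol z)$-type if all singular points in $\mathbb C^*$ lie in $\{z_1,z_2\}$ and the exponents at $z_a$ are $0<1+m_a$, $a=1,2$. **Special spaces of quasi-exponentials ($N=M=2$).** Let $z^u=e^{u\ln z}$ with fixed arguments of $z_1,z_2$; $q_a\in\mathbb C[u]$ of degree $m_a$; $U$ the 2-dimensional span of $z_1^uq_1,z_2^uq_2$. The discrete exponents of $U$ at $\mu\in\mathbb C$ are the unique nonnegative integers $c_1<c_2$ for which there is a basis $g_1,g_2$ of $U$ with $g_i(\mu+j)=0$ for $0\le j<c_i$ and $g_i(\mu+c_i)\ne0$.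 For $\mu_1-\mu_2\notin\mathbb Z$, $(U,\boldsymbol\mu)$ is of the $(\boldsymbol m,\boldsymbol z,\boldsymbol n,\boldsymbol\mu)$-type if the discrete exponents of $U$ at $\mu_i$ are $0<1+n_i$, $i=1,2$, and $n_1+n_2=m_1+m_2$. **Special bispectral dual.** Given $(V,\boldsymbol z)$ of the $(\boldsymbol n,\boldsymbol\lambda,\boldsymbol m,\boldsymbol z)$-type, let $V^\star=\{f/\mathrm{Wr}_V: f\in V\}$, where $\mathrm{Wr}_V$ is the Wronskian of a basis of $V$. The special bispectral dual space $U$ is the span of all functions $\int_{\gamma_a}x^uf(x)\,x^{-2}(x-z_1)^{-1}(x-z_2)^{-1}dx$, $a=1,2$, $f\in V^\star$, where $\gamma_a$ is a small counterclockwise circle around $z_a$ and the branch of $\ln x$ near $z_a$ is given by the fixed argument of $z_a$. Then $(U,\boldsymbol\lambda+\boldsymbol1)$ is of the $(\boldsymbol m,\boldsymbol z,\boldsymbol n,\boldsymbol\lambda+\boldsymbol1)$-type. The coefficients $c_i,d_i,e_i,f_i$ are uniquely determined by the displayed expansions (the displayed products form bases of the polynomials of the corresponding degree bound).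
   Formalization: The formal statement additionally assumes that p_1 and p_2 are both nonzero at z_1 and at z_2; without this the claim fails (e.g. λ=(0,1/2), z=(1,-1), p_1=x+1, p_2=1, where c_0=1 but d_0=0), and the condition is necessary for nonzero A, B, C. *)

theory Defs
  imports "HOL-Complex_Analysis.Complex_Analysis" "HOL-Library.Function_Algebras"
begin

definition cscale :: "complex \<Rightarrow> (complex \<Rightarrow> complex) \<Rightarrow> complex \<Rightarrow> complex" where
  "cscale a f = (\<lambda>x. a * f x)"

global_interpretation cfun: vector_space cscale
  by unfold_locales (auto simp: cscale_def fun_eq_iff algebra_simps)

definition is_basis2 :: "(complex \<Rightarrow> complex) set \<Rightarrow> (complex \<Rightarrow> complex) \<Rightarrow> (complex \<Rightarrow> complex) \<Rightarrow> bool" where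
  "is_basis2 W g h \<longleftrightarrow> g \<noteq> h \<and> cfun.independent {g, h} \<and> cfun.span {g, h} = W"


(* A point of C^* with a chosen argument is encoded by a logarithm w, the point being exp w.
   ln_branch w is the branch of ln with value w at exp w; it is holomorphic off the closed ray
   from 0 opposite to exp w.  A multivalued function on C^* is handled through its branches near
   exp w, and a space of multivalued functions through the family of spaces V w of these branches. *)
definition ln_branch :: "complex \<Rightarrow> complex \<Rightarrow> complex" where
  "ln_branch w x = w + Ln (x / exp w)"

definition quasi_polynomials ::
  "complex \<Rightarrow> complex poly \<Rightarrow> complex \<Rightarrow> complex poly \<Rightarrow> complex \<Rightarrow> (complex \<Rightarrow> complex) set" where
  "quasi_polynomials l1 p1 l2 p2 w =
     cfun.span {\<lambda>x. exp (l1 * ln_branch w x) * poly p1 x, \<lambda>x. exp (l2 * ln_branch w x) * poly p2 x}"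

definition exponents :: "(complex \<Rightarrow> complex) set \<Rightarrow> complex \<Rightarrow> int set" where
  "exponents W z = (\<lambda>f. zorder f z) ` (W - {0})"

(* The space V spanned by x^l1 p1 and x^l2 p2, together with (z1, z2), is of the
   ((n1, n2), (l1, l2), (m1, m2), (z1, z2))-type.  The exponents at a point do not depend on
   the chosen logarithm w of that point. *)
definition quasi_polynomial_type ::
  "nat \<Rightarrow> nat \<Rightarrow> complex \<Rightarrow> complex \<Rightarrow> nat \<Rightarrow> nat \<Rightarrow> complex \<Rightarrow> complex \<Rightarrow> complex poly \<Rightarrow> complex poly \<Rightarrow> bool" where
  "quasi_polynomial_type n1 n2 l1 l2 m1 m2 z1 z2 p1 p2 \<longleftrightarrow>
     l1 - l2 \<notin> \<int> \<and> z1 \<noteq> 0 \<and> z2 \<noteq> 0 \<and> z1 \<noteq> z2 \<and>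
     degree p1 = n1 \<and> degree p2 = n2 \<and> poly p1 0 \<noteq> 0 \<and> poly p2 0 \<noteq> 0 \<and>
     (\<forall>w. exponents (quasi_polynomials l1 p1 l2 p2 w) (exp w) \<noteq> {0, 1} \<longrightarrow> exp w \<in> {z1, z2}) \<and>
     (\<forall>w. exp w = z1 \<longrightarrow> exponents (quasi_polynomials l1 p1 l2 p2 w) z1 = {0, 1 + int m1}) \<and>
     (\<forall>w. exp w = z2 \<longrightarrow> exponents (quasi_polynomials l1 p1 l2 p2 w) z2 = {0, 1 + int m2})"


(* The functions z^u are exp (u * w) with w the logarithm of z given by its fixed argument. *)
definition quasi_exponentials ::
  "complex \<Rightarrow> complex poly \<Rightarrow> complex \<Rightarrow> complex poly \<Rightarrow> (complex \<Rightarrow> complex) set" where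
  "quasi_exponentials w1 q1 w2 q2 = cfun.span {\<lambda>u. exp (u * w1) * poly q1 u, \<lambda>u. exp (u * w2) * poly q2 u}"

definition has_discrete_exponents :: "(complex \<Rightarrow> complex) set \<Rightarrow> complex \<Rightarrow> nat \<Rightarrow> nat \<Rightarrow> bool" where
  "has_discrete_exponents W \<mu> c1 c2 \<longleftrightarrow> c1 < c2 \<and>
     (\<exists>g1 g2. is_basis2 W g1 g2 \<and>
        (\<forall>j<c1. g1 (\<mu> + of_nat j) = 0) \<and> g1 (\<mu> + of_nat c1) \<noteq> 0 \<and>
        (\<forall>j<c2. g2 (\<mu> + of_nat j) = 0) \<and> g2 (\<mu> + of_nat c2) \<noteq> 0)"

(* The space U spanned by z1^u q1 and z2^u q2 (za = exp wa), together with (\<mu>1, \<mu>2), is of the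
   ((m1, m2), (z1, z2), (n1, n2), (\<mu>1, \<mu>2))-type. *)
definition quasi_exponential_type ::
  "nat \<Rightarrow> nat \<Rightarrow> complex \<Rightarrow> complex \<Rightarrow> nat \<Rightarrow> nat \<Rightarrow> complex \<Rightarrow> complex \<Rightarrow> complex poly \<Rightarrow> complex poly \<Rightarrow> bool" where
  "quasi_exponential_type m1 m2 w1 w2 n1 n2 \<mu>1 \<mu>2 q1 q2 \<longleftrightarrow>
     exp w1 \<noteq> exp w2 \<and> \<mu>1 - \<mu>2 \<notin> \<int> \<and> n1 + n2 = m1 + m2 \<and>
     q1 \<noteq> 0 \<and> q2 \<noteq> 0 \<and> degree q1 = m1 \<and> degree q2 = m2 \<and>
     has_discrete_exponents (quasi_exponentials w1 q1 w2 q2) \<mu>1 0 (1 + n1) \<and>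
     has_discrete_exponents (quasi_exponentials w1 q1 w2 q2) \<mu>2 0 (1 + n2)"


definition wronskian :: "(complex \<Rightarrow> complex) \<Rightarrow> (complex \<Rightarrow> complex) \<Rightarrow> complex \<Rightarrow> complex" where
  "wronskian g h x = g x * deriv h x - deriv g x * h x"

(* Two bases have proportional Wronskians (where the functions are holomorphic), so the choice
   of the basis is immaterial. *)
definition star_space :: "(complex \<Rightarrow> complex) set \<Rightarrow> (complex \<Rightarrow> complex) set" where
  "star_space W = {\<lambda>x. f x / wronskian g h x | f g h. f \<in> W \<and> is_basis2 W g h}"

(* The integrals over small circles around exp w: the radius r is any sufficiently small one. *)
definition bispectral_integrals ::
  "complex \<Rightarrow> complex \<Rightarrow> (complex \<Rightarrow> (complex \<Rightarrow> complex) set) \<Rightarrow> complex \<Rightarrow> (complex \<Rightarrow> complex) set" where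
  "bispectral_integrals z1 z2 V w =
     {g. \<exists>f\<in>star_space (V w). \<forall>\<^sub>F r in at_right 0. \<forall>u.
        g u = contour_integral (circlepath (exp w) r)
                (\<lambda>x. exp (u * ln_branch w x) * f x * x powi (-2) * inverse (x - z1) * inverse (x - z2))}"

definition special_bispectral_dual ::
  "complex \<Rightarrow> complex \<Rightarrow> (complex \<Rightarrow> (complex \<Rightarrow> complex) set) \<Rightarrow> (complex \<Rightarrow> complex) set" where
  "special_bispectral_dual w1 w2 V =
     cfun.span (bispectral_integrals (exp w1) (exp w2) V w1 \<union> bispectral_integrals (exp w1) (exp w2) V w2)"

(* Equivalently: neither x^l1 p1 nor x^l2 p2 itself realizes the exponent 1 + ma of V at za.
   The comparison of the coefficients c, d, e, f needs this (with all three constants nonzero, it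
   is also necessary): for l1 = 0, l2 = 1/2, z1 = 1, z2 = -1, p1 = x + 1, p2 = 1, of type
   n = m = (1, 0), one has c 0 = 1 and d 0 = 0. *)
definition nondegenerate :: "complex poly \<Rightarrow> complex poly \<Rightarrow> complex \<Rightarrow> complex \<Rightarrow> bool" where
  "nondegenerate p1 p2 z1 z2 \<longleftrightarrow>
     poly p1 z1 \<noteq> 0 \<and> poly p1 z2 \<noteq> 0 \<and> poly p2 z1 \<noteq> 0 \<and> poly p2 z2 \<noteq> 0"

end

theory Submission
  imports Defs
    "HOL-Computational_Algebra.Polynomial_Factorial"
    "HOL-Computational_Algebra.Field_as_Ring"
    "HOL-Computational_Algebra.Fundamental_Theorem_Algebra"
begin

text \<open>
  All four coefficient sequences satisfy one and the same three-term recurrence (\<open>tridiag\<close>), and on the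
  range of indices in question a solution of it is determined up to a factor.

  The exponents of \<open>V\<close> at \<open>z1\<close> and \<open>z2\<close> determine the Wronskian of \<open>V\<close>: it is a power of \<open>x\<close> times a constant
  multiple of \<open>(x - z1) ^ m1 * (x - z2) ^ m2\<close> (\<open>linear_power_dvd_wronskian_poly\<close>, \<open>wronskian_poly_factorization\<close>).
  Consequently the polynomials \<open>p1\<close> and \<open>p2\<close> solve Heun equations that share one unknown number, the accessory
  parameter \<open>h\<close> (\<open>heun_equations\<close>). In the basis of products of powers of \<open>x - z1\<close> and \<open>x - z2\<close>, which is adapted
  to two of the four singular points, Heun's equation is a three-term recurrence (\<open>heun_binary_form\<close>). The
  recurrence of \<open>p1\<close> turns into that of \<open>p2\<close> by reflecting the index and rescaling with powers of \<open>z1 / z2\<close>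
  (\<open>tridiag_reflect\<close>).

  On the dual side, integration by parts against \<open>x powr u\<close> turns the differential equation of \<open>V\<close> into a
  second-order difference equation satisfied by all functions in \<open>U\<close>
  (\<open>special_bispectral_dual_difference_equation\<close>). Its middle coefficient contains the same \<open>h\<close>. In the given
  basis of factorial products it is again a three-term recurrence, and that recurrence is the one of \<open>p2\<close>, directly
  for \<open>q2\<close> and with reflected index for \<open>q1\<close> (\<open>difference_equation_recurrence\<close>).

  Let \<open>\<alpha>\<close> be the larger of \<open>0\<close> and \<open>n2 - m1\<close>, and \<open>\<beta>\<close> the smaller of \<open>n2\<close> and \<open>m2\<close>. Between \<open>\<alpha>\<close> and \<open>\<beta>\<close> the
  value at \<open>\<alpha>\<close> determines a solution (\<open>tridiag_core\<close>), so the four sequences are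
  proportional as soon as none of them vanishes at \<open>\<alpha>\<close>. A sequence that vanishes at \<open>\<alpha>\<close> would vanish
  from \<open>\<alpha>\<close> to \<open>\<beta>\<close> and decouple into a left and a right part (\<open>tridiag_vanish\<close>). Each part would give a polynomial
  solution of the Heun equation of \<open>p1\<close> or of \<open>p2\<close> that vanishes at \<open>z1\<close> or \<open>z2\<close>. Since the difference
  \<open>l1 - l2\<close> is no integer, polynomial solutions are unique up to a factor (\<open>heun_unique\<close>), and nondegeneracy
  says that \<open>p1\<close> and \<open>p2\<close> vanish at neither point; so both parts are zero.
\<close>

section \<open>Heun's equation and its polynomial solutions\<close>

text \<open>
  The Fuchsian equation with singular points \<open>0\<close>, \<open>z1\<close>, \<open>z2\<close>, \<open>\<infinity>\<close> and exponents \<open>{0, - dl}\<close> at \<open>0\<close>,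
  \<open>{0, 1 + m1}\<close> at \<open>z1\<close>, \<open>{0, 1 + m2}\<close> at \<open>z2\<close>. One exponent at infinity is fixed so that the polynomial
  solutions have degree \<open>n\<close>; the number \<open>h\<close> is the accessory parameter, which the exponents leave free.
\<close>
definition heun :: "nat \<Rightarrow> nat \<Rightarrow> complex \<Rightarrow> complex \<Rightarrow> nat \<Rightarrow> complex \<Rightarrow> complex \<Rightarrow> complex poly \<Rightarrow> complex poly" where
  "heun m1 m2 z1 z2 n dl h p =
     [:-z1, 1:] * [:-z2, 1:] * ([:0, 1:] * pderiv (pderiv p) + smult (1 + dl) (pderiv p))
     - [:0, 1:] * (smult (of_nat m1) [:-z2, 1:] + smult (of_nat m2) [:-z1, 1:]) * pderiv p
     - [:h, - of_nat n * (of_nat m1 + of_nat m2 - of_nat n - dl):] * p"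

text \<open>
  In the coordinate \<open>(x - z2) / (x - z1)\<close> these are, up to a common factor, the divided monomials; the points
  \<open>z1\<close> and \<open>z2\<close> are its pole and its zero.
\<close>
definition binary_monomial :: "complex \<Rightarrow> complex \<Rightarrow> nat \<Rightarrow> nat \<Rightarrow> complex poly" where
  "binary_monomial z1 z2 n k =
     smult (1 / (fact (n - k) * fact k)) ([:-z1, 1:] ^ (n - k) * [:-z2, 1:] ^ k)"

definition binary_form :: "complex \<Rightarrow> complex \<Rightarrow> nat \<Rightarrow> (int \<Rightarrow> complex) \<Rightarrow> complex poly" where
  "binary_form z1 z2 n s = (\<Sum>k\<le>n. smult (s (int k)) (binary_monomial z1 z2 n k))"

text \<open>
  The defect of a sequence in the three-term recurrence equivalent to Heun's equation. Indices are integers,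
  so that a reflection of the index stays inside the same formalism. The coefficient of \<open>s (k - 1)\<close> vanishes at
  \<open>k = 0\<close> and \<open>k = n - m1\<close>, that of \<open>s (k + 1)\<close> at \<open>k = n\<close> and \<open>k = m2\<close>: the recurrence decouples there.
\<close>
definition tridiag ::
  "nat \<Rightarrow> nat \<Rightarrow> complex \<Rightarrow> complex \<Rightarrow> nat \<Rightarrow> complex \<Rightarrow> complex \<Rightarrow> (int \<Rightarrow> complex) \<Rightarrow> int \<Rightarrow> complex" where
  "tridiag m1 m2 z1 z2 n dl h s k =
     z1 * of_int (k * (int m1 - int n + k)) * s (k - 1)
     + z2 * of_int ((int n - k) * (int m2 - k)) * s (k + 1)
     + (h + z1 * of_int k * (of_int (k - int m2) + dl)
          + z2 * of_int (int n - k) * (of_int (int n - k - int m1) + dl)) * s k"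

lemma heun_diff:
  "heun m1 m2 z1 z2 n dl h (p - smult a q) =
     heun m1 m2 z1 z2 n dl h p - smult a (heun m1 m2 z1 z2 n dl h q)"
  by (simp add: heun_def pderiv_diff pderiv_smult smult_diff_right smult_add_right smult_add_left
      algebra_simps)

text \<open>
  The factor in front of the coefficient is the indicial polynomial at infinity: a solution of degree \<open>r\<close>
  needs \<open>r = n\<close> or \<open>r = m1 + m2 - n - dl\<close>, and the latter is no integer when \<open>dl\<close> is none.
\<close>
lemma coeff_heun_top:
  assumes "degree p \<le> r"
  shows "coeff (heun m1 m2 z1 z2 n dl h p) (Suc r) =
      (of_nat r - of_nat n) * (of_nat r + of_nat n - of_nat m1 - of_nat m2 + dl) * coeff p r"
proof -
  have z: "coeff p (Suc r + j) = 0" for j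
    using assms by (auto intro!: coeff_eq_0)
  have q: "coeff ([:a, b, c:] * q) (Suc r) =
      a * coeff q (Suc r) + b * coeff q r + (case r of 0 \<Rightarrow> 0 | Suc j \<Rightarrow> c * coeff q j)" for a b c q
    by (cases r) (simp_all add: coeff_pCons add.assoc)
  define N where "N = (of_nat m1 + of_nat m2 :: complex)"
  have e: "heun m1 m2 z1 z2 n dl h p =
     [:z1 * z2, - (z1 + z2), 1:] * ([:0, 1:] * pderiv (pderiv p) + smult (1 + dl) (pderiv p))
     - [:0, - (of_nat m1 * z2 + of_nat m2 * z1), N:] * pderiv p
     - [:h, - of_nat n * (N - of_nat n - dl), 0:] * p"
    unfolding heun_def by (rule arg_cong2[of _ _ _ _ "(-)"])+ (simp_all add: N_def algebra_simps)
  show ?thesis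
    using z[of 0] z[of 1] z[of 2] z[of 3] unfolding e coeff_diff q
    by (cases r) (simp_all add: coeff_pCons coeff_pderiv N_def algebra_simps split: nat.split)
qed

lemma degree_heun_le:
  assumes "degree p = n"
  shows "degree (heun m1 m2 z1 z2 n dl h p) \<le> n"
proof (rule degree_le, intro allI impI)
  fix i assume "n < i"
  then obtain r where r: "i = Suc r" "n \<le> r" by (cases i) auto
  then show "coeff (heun m1 m2 z1 z2 n dl h p) i = 0"
    using assms by (cases "r = n") (simp_all add: coeff_heun_top coeff_eq_0)
qed

lemma heun_degree:
  assumes "heun m1 m2 z1 z2 n dl h p = 0" "p \<noteq> 0" "dl \<notin> \<int>"
  shows "degree p = n"
proof (rule ccontr)
  define r where "r = degree p"
  assume "degree p \<noteq> n"
  then have rn: "of_nat r - of_nat n \<noteq> (0::complex)"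
    by (simp add: r_def)
  have dl: "of_nat r + of_nat n - of_nat m1 - of_nat m2 + dl \<noteq> 0"
  proof
    assume "of_nat r + of_nat n - of_nat m1 - of_nat m2 + dl = 0"
    then have "dl = of_int (int m1 + int m2 - int r - int n)"
      by (simp add: algebra_simps add_eq_0_iff2)
    then show False using \<open>dl \<notin> \<int>\<close> by auto
  qed
  have "coeff (heun m1 m2 z1 z2 n dl h p) (Suc r) =
      (of_nat r - of_nat n) * (of_nat r + of_nat n - of_nat m1 - of_nat m2 + dl) * coeff p r"
    by (simp add: coeff_heun_top r_def)
  then show False using assms rn dl by (simp add: r_def)
qed

text \<open>
  Two polynomial solutions have the same degree, so a combination of them that cancels the leading
  coefficient is a solution of smaller degree, hence zero.
\<close>
lemma heun_unique:
  assumes "heun m1 m2 z1 z2 n dl h p = 0" "heun m1 m2 z1 z2 n dl h q = 0" "dl \<notin> \<int>" "q \<noteq> 0"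
  obtains a where "p = smult a q"
proof -
  define a where "a = coeff p n / coeff q n"
  have dq: "degree q = n" using heun_degree assms by blast
  have cq: "coeff q n \<noteq> 0" using \<open>q \<noteq> 0\<close> dq leading_coeff_0_iff by blast
  have "heun m1 m2 z1 z2 n dl h (p - smult a q) = 0"
    using assms by (simp add: heun_diff)
  then have "p - smult a q = 0 \<or> degree (p - smult a q) = n"
    using heun_degree assms(3) by blast
  moreover have "coeff (p - smult a q) n = 0" using cq by (simp add: a_def)
  ultimately have "p - smult a q = 0" using leading_coeff_0_iff by blast
  then show ?thesis using that[of a] by simp
qed

section \<open>The three-term recurrence of the coefficients\<close>

lemma poly_eq_off_finite:
  fixes p q :: "complex poly"
  assumes "finite S" "\<And>x. x \<notin> S \<Longrightarrow> poly p x = poly q x"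
  shows "p = q"
proof -
  have "infinite (- S)" using assms(1) infinite_UNIV_char_0 by (metis finite_compl)
  moreover have "- S \<subseteq> {x. poly (p - q) x = 0}" using assms(2) by auto
  ultimately have "infinite {x. poly (p - q) x = 0}" using finite_subset by blast
  then have "p - q = 0" using poly_roots_finite by blast
  then show ?thesis by simp
qed

lemma poly_pderiv_linear_power:
  assumes "x \<noteq> a"
  shows "poly (pderiv ([:-a, 1:] ^ j)) x = of_nat j / (x - a) * (x - (a::complex)) ^ j"
proof (cases j)
  case (Suc i)
  then show ?thesis using assms by (simp add: pderiv_power_Suc pderiv_pCons del: power_Suc) (simp add: field_simps)
qed auto

lemma poly_pderiv2_linear_power:
  assumes "x \<noteq> a"
  shows "poly (pderiv (pderiv ([:-a, 1:] ^ j))) x =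
    of_nat j * (of_nat j - 1) / (x - a)^2 * (x - (a::complex)) ^ j"
proof (cases j)
  case (Suc i)
  have "pderiv (pderiv ([:-a, 1:] ^ j)) = smult (of_nat (Suc i)) (pderiv ([:-a, 1:] ^ i))"
    by (simp add: Suc pderiv_power_Suc pderiv_pCons pderiv_smult del: power_Suc)
  then show ?thesis using assms
    by (simp add: Suc poly_pderiv_linear_power power2_eq_square divide_simps)
qed auto

lemma pderiv_binary_monomial:
  assumes "x \<noteq> z1" "x \<noteq> z2" "k \<le> n"
  shows "poly (pderiv (binary_monomial z1 z2 n k)) x =
      (of_nat (n - k) / (x - z1) + of_nat k / (x - z2)) * poly (binary_monomial z1 z2 n k) x"
    and "poly (pderiv (pderiv (binary_monomial z1 z2 n k))) x =
      (of_nat (n - k) * (of_nat (n - k) - 1) / (x - z1)^2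
        + 2 * of_nat (n - k) * of_nat k / ((x - z1) * (x - z2))
        + of_nat k * (of_nat k - 1) / (x - z2)^2) * poly (binary_monomial z1 z2 n k) x"
proof -
  define u v u' v' where "u = of_nat (n - k) / (x - z1)" and "v = of_nat k / (x - z2)"
    and "u' = of_nat (n - k) * (of_nat (n - k) - 1) / (x - z1)^2"
    and "v' = of_nat k * (of_nat k - 1) / (x - z2)^2"
  have c: "2 * of_nat (n - k) * of_nat k / ((x - z1) * (x - z2)) = 2 * u * v"
    by (simp add: u_def v_def)
  note d = poly_pderiv_linear_power[OF assms(1), of "n - k", folded u_def]
    poly_pderiv_linear_power[OF assms(2), of k, folded v_def]
    poly_pderiv2_linear_power[OF assms(1), of "n - k", folded u'_def]
    poly_pderiv2_linear_power[OF assms(2), of k, folded v'_def]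
  define r where "r = (1 / (fact (n - k) * fact k) :: complex)"
  show "poly (pderiv (binary_monomial z1 z2 n k)) x =
      (of_nat (n - k) / (x - z1) + of_nat k / (x - z2)) * poly (binary_monomial z1 z2 n k) x"
    unfolding binary_monomial_def u_def[symmetric] v_def[symmetric] r_def[symmetric]
    by (simp only: pderiv_smult pderiv_mult pderiv_add poly_smult poly_mult poly_add d)
      (simp add: algebra_simps)
  show "poly (pderiv (pderiv (binary_monomial z1 z2 n k))) x =
      (of_nat (n - k) * (of_nat (n - k) - 1) / (x - z1)^2
        + 2 * of_nat (n - k) * of_nat k / ((x - z1) * (x - z2))
        + of_nat k * (of_nat k - 1) / (x - z2)^2) * poly (binary_monomial z1 z2 n k) x"
    unfolding binary_monomial_def c u'_def[symmetric] v'_def[symmetric] r_def[symmetric]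
    by (simp only: pderiv_smult pderiv_mult pderiv_add poly_smult poly_mult poly_add d)
      (simp add: algebra_simps)
qed

text \<open>
  Multiplication by \<open>(x - z2) / (x - z1)\<close> or by its inverse moves the index by one. The natural-number
  subtraction inside \<open>binary_monomial\<close> makes the boundary cases separate, and there the factor \<open>n - k\<close> or \<open>k\<close>
  is zero.
\<close>
lemma binary_monomial_shift:
  assumes "x \<noteq> z1"
  shows "of_nat (n - k) * ((x - z2) / (x - z1)) * poly (binary_monomial z1 z2 n k) x =
     (if k < n then of_nat (Suc k) * poly (binary_monomial z1 z2 n (Suc k)) x else 0)"
proof (cases "k < n")
  case True
  define i where "i = n - Suc k"
  have i: "n - k = Suc i" "n - Suc k = i" using True by (auto simp: i_def)
  show ?thesis using True assms
    by (simp add: binary_monomial_def i divide_simps del: of_nat_Suc) (simp add: algebra_simps)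
qed simp

lemma binary_monomial_shift':
  assumes "x \<noteq> z2" "k \<le> n"
  shows "of_nat k * ((x - z1) / (x - z2)) * poly (binary_monomial z1 z2 n k) x =
     (if k > 0 then of_nat (Suc n - k) * poly (binary_monomial z1 z2 n (k - 1)) x else 0)"
proof (cases k)
  case (Suc i)
  have i: "n - i = Suc (n - k)" "Suc n - k = Suc (n - k)" using assms Suc by auto
  show ?thesis using Suc i assms
    by (simp add: binary_monomial_def divide_simps del: of_nat_Suc) (simp add: algebra_simps)
qed auto

lemma poly_heun:
  "poly (heun m1 m2 z1 z2 n dl h p) x =
     (x - z1) * (x - z2) * (x * poly (pderiv (pderiv p)) x + (1 + dl) * poly (pderiv p) x)
     - x * (of_nat m1 * (x - z2) + of_nat m2 * (x - z1)) * poly (pderiv p) x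
     - (h - x * of_nat n * (of_nat m1 + of_nat m2 - of_nat n - dl)) * poly p x"
  unfolding heun_def by (simp add: algebra_simps)

text \<open>
  The quotients \<open>R = Y / X\<close> and \<open>S = X / Y\<close>, with \<open>X = x - z1\<close> and \<open>Y = x - z2\<close>, absorb all denominators that the
  logarithmic derivatives of a binary monomial produce. Since \<open>x * R = Y + z1 * R\<close> and \<open>x * S = X + z2 * S\<close>,
  only the shifts by one remain; the terms linear in \<open>x\<close> cancel because of the choice of the exponent at infinity.
\<close>
lemma heun_binary_monomial:
  assumes x: "x \<noteq> z1" "x \<noteq> z2" and k: "k \<le> n"
  defines "M \<equiv> \<lambda>k. poly (binary_monomial z1 z2 n k) x"
  shows "poly (heun m1 m2 z1 z2 n dl h (binary_monomial z1 z2 n k)) x =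
     z1 * (of_nat n - of_nat k - 1 - of_nat m1) * (if k < n then of_nat (Suc k) * M (Suc k) else 0)
     + z2 * (of_nat k - 1 - of_nat m2) * (if k > 0 then of_nat (Suc n - k) * M (k - 1) else 0)
     - (h + z1 * of_nat k * (of_nat k - of_nat m2 + dl)
          + z2 * (of_nat n - of_nat k) * (of_nat n - of_nat k - of_nat m1 + dl)) * M k"
proof -
  define N where "N = (of_nat n :: complex)"
  define K where "K = (of_nat k :: complex)"
  have nk: "(of_nat (n - k)::complex) = N - K" using k by (simp add: of_nat_diff N_def K_def)
  define X where "X = x - z1"
  define Y where "Y = x - z2"
  have XY: "X \<noteq> 0" "Y \<noteq> 0" using x by (auto simp: X_def Y_def)
  define R where "R = Y / X"
  define S where "S = X / Y"
  define D where "D = (N - K) / X + K / Y"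
  define D' where "D' = (N - K) * (N - K - 1) / X^2 + 2 * (N - K) * K / (X * Y) + K * (K - 1) / Y^2"
  have p1: "poly (pderiv (binary_monomial z1 z2 n k)) x = D * M k"
    and p2: "poly (pderiv (pderiv (binary_monomial z1 z2 n k))) x = D' * M k"
    using pderiv_binary_monomial[OF x k] nk
    by (simp_all add: M_def X_def Y_def K_def D_def D'_def)
  have xR: "x * R = Y + z1 * R" and xS: "x * S = X + z2 * S"
    using XY by (simp_all add: R_def S_def X_def Y_def field_simps)
  have D1: "X * Y * D = (N - K) * Y + K * X" "Y * D = (N - K) * R + K" "X * D = (N - K) + K * S"
    using XY by (simp_all add: D_def R_def S_def distrib_left)
  have "X * Y * (a / X^2 + b / (X * Y) + c / Y^2) = a * R + b + c * S" for a b c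
    using XY by (simp add: R_def S_def distrib_left power2_eq_square mult.commute)
  then have D2: "X * Y * D' = (N - K) * (N - K - 1) * R + 2 * (N - K) * K + K * (K - 1) * S"
    by (simp only: D'_def)
  have "poly (heun m1 m2 z1 z2 n dl h (binary_monomial z1 z2 n k)) x =
     (x * (X * Y * D') + (1 + dl) * (X * Y * D)
      - x * (of_nat m1 * (Y * D) + of_nat m2 * (X * D))
      - (h - x * N * (of_nat m1 + of_nat m2 - N - dl))) * M k"
    unfolding poly_heun p1 p2 M_def[THEN meta_eq_to_obj_eq, THEN fun_cong, symmetric] X_def[symmetric] Y_def[symmetric] N_def[symmetric]
    by (simp only: algebra_simps)
  also have "\<dots> = ((N - K) * (N - K - 1) * (x * R) + 2 * (N - K) * K * x + K * (K - 1) * (x * S)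
      + (1 + dl) * ((N - K) * Y + K * X)
      - of_nat m1 * ((N - K) * (x * R) + K * x) - of_nat m2 * ((N - K) * x + K * (x * S))
      - (h - x * N * (of_nat m1 + of_nat m2 - N - dl))) * M k"
    unfolding D1 D2 by (simp only: algebra_simps)
  also have "\<dots> = z1 * (N - K - 1 - of_nat m1) * ((N - K) * R * M k)
     + z2 * (K - 1 - of_nat m2) * (K * S * M k)
     - (h + z1 * K * (K - of_nat m2 + dl)
          + z2 * (N - K) * (N - K - of_nat m1 + dl)) * M k"
    unfolding xR xS by (simp add: X_def Y_def algebra_simps)
  also have "(N - K) * R * M k = (if k < n then of_nat (Suc k) * M (Suc k) else 0)"
    using binary_monomial_shift[OF x(1), of n k z2] nk by (simp add: M_def X_def Y_def R_def)
  also have "K * S * M k = (if k > 0 then of_nat (Suc n - k) * M (k - 1) else 0)"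
    using binary_monomial_shift'[OF x(2) k, of z1] by (simp add: M_def X_def Y_def K_def S_def)
  finally show ?thesis by (simp add: N_def K_def)
qed

lemma heun_sum:
  "heun m1 m2 z1 z2 n dl h (\<Sum>k\<in>A. smult (s k) (p k)) =
     (\<Sum>k\<in>A. smult (s k) (heun m1 m2 z1 z2 n dl h (p k)))"
proof (cases "finite A")
  case True
  then show ?thesis
  proof (induction A rule: finite_induct)
    case (insert a A)
    have "heun m1 m2 z1 z2 n dl h (smult (s a) (p a) + (\<Sum>k\<in>A. smult (s k) (p k))) =
      heun m1 m2 z1 z2 n dl h (\<Sum>k\<in>A. smult (s k) (p k)) + smult (s a) (heun m1 m2 z1 z2 n dl h (p a))"
      using heun_diff[of m1 m2 z1 z2 n dl h "\<Sum>k\<in>A. smult (s k) (p k)" "- s a" "p a"]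
      by (simp add: add.commute)
    then show ?case using insert by (simp add: add.commute)
  qed (simp add: heun_def)
qed (simp add: heun_def)

text \<open>
  Transposition of an operator that sends the \<open>k\<close>-th element of a divided basis to a combination of its
  neighbours: collecting the coefficient of \<open>M k\<close> turns it into a three-term recurrence.
\<close>
lemma sum_tridiagonal:
  fixes s A B C :: "int \<Rightarrow> complex" and M :: "nat \<Rightarrow> complex"
  shows "(\<Sum>k\<le>n. s (int k) * (A (int k) * (if k < n then of_nat (Suc k) * M (Suc k) else 0)
            + B (int k) * (if k > 0 then of_nat (Suc n - k) * M (k - 1) else 0) + C (int k) * M k)) =
    (\<Sum>k\<le>n. (of_nat k * A (int k - 1) * s (int k - 1) + of_nat (n - k) * B (int k + 1) * s (int k + 1)
            + C (int k) * s (int k)) * M k)"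
proof -
  have 1: "(\<Sum>k\<le>n. s (int k) * (A (int k) * (if k < n then of_nat (Suc k) * M (Suc k) else 0))) =
     (\<Sum>k\<le>n. of_nat k * A (int k - 1) * s (int k - 1) * M k)"
  proof (cases n)
    case (Suc j)
    show ?thesis unfolding Suc
      by (subst sum.atMost_Suc, subst sum.atMost_Suc_shift) (auto intro!: sum.cong simp: mult_ac)
  qed simp
  have 2: "(\<Sum>k\<le>n. s (int k) * (B (int k) * (if k > 0 then of_nat (Suc n - k) * M (k - 1) else 0))) =
     (\<Sum>k\<le>n. of_nat (n - k) * B (int k + 1) * s (int k + 1) * M k)"
  proof (cases n)
    case (Suc j)
    show ?thesis unfolding Suc
      by (subst sum.atMost_Suc_shift, subst sum.atMost_Suc) (auto intro!: sum.cong simp: mult_ac add_ac)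
  qed simp
  show ?thesis
    unfolding distrib_left distrib_right sum.distrib 1 2 by (simp add: mult_ac)
qed

lemma heun_binary_form:
  "heun m1 m2 z1 z2 n dl h (binary_form z1 z2 n s) =
     - binary_form z1 z2 n (tridiag m1 m2 z1 z2 n dl h s)"
proof (rule poly_eq_off_finite[of "{z1, z2}"])
  fix x assume "x \<notin> {z1, z2}"
  then have x: "x \<noteq> z1" "x \<noteq> z2" by auto
  define M where "M = (\<lambda>k. poly (binary_monomial z1 z2 n k) x)"
  define A where "A = (\<lambda>k::int. z1 * (of_nat n - of_int k - 1 - of_nat m1))"
  define B where "B = (\<lambda>k::int. z2 * (of_int k - 1 - of_nat m2))"
  define C where "C = (\<lambda>k::int. - (h + z1 * of_int k * (of_int k - of_nat m2 + dl)
          + z2 * (of_nat n - of_int k) * (of_nat n - of_int k - of_nat m1 + dl)))"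
  have "poly (heun m1 m2 z1 z2 n dl h (binary_form z1 z2 n s)) x =
    (\<Sum>k\<le>n. s (int k) * poly (heun m1 m2 z1 z2 n dl h (binary_monomial z1 z2 n k)) x)"
    by (simp add: binary_form_def heun_sum poly_sum)
  also have "\<dots> = (\<Sum>k\<le>n. s (int k) * (A (int k) * (if k < n then of_nat (Suc k) * M (Suc k) else 0)
            + B (int k) * (if k > 0 then of_nat (Suc n - k) * M (k - 1) else 0) + C (int k) * M k))"
    unfolding A_def B_def C_def M_def
    by (intro sum.cong refl arg_cong2[of _ _ _ _ "(*)"])
      (simp only: heun_binary_monomial[OF x] atMost_iff of_int_of_nat_eq diff_conv_add_uminus minus_mult_left)
  also have "\<dots> = (\<Sum>k\<le>n. - tridiag m1 m2 z1 z2 n dl h s (int k) * M k)"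
    unfolding sum_tridiagonal
    by (intro sum.cong refl arg_cong2[of _ _ _ _ "(*)"])
      (simp add: A_def B_def C_def tridiag_def of_nat_diff algebra_simps)
  finally show "poly (heun m1 m2 z1 z2 n dl h (binary_form z1 z2 n s)) x =
     poly (- binary_form z1 z2 n (tridiag m1 m2 z1 z2 n dl h s)) x"
    by (simp add: binary_form_def poly_sum M_def sum_negf)
qed simp

text \<open>
  Divided by \<open>(x - z1) ^ n\<close>, a binary form is a polynomial in \<open>t = (x - z2) / (x - z1)\<close>, and \<open>t\<close> takes every value
  other than \<open>1\<close>.
\<close>
lemma binary_form_eq_0:
  assumes "z1 \<noteq> z2" "binary_form z1 z2 n s = 0" "k \<le> n"
  shows "s (int k) = 0"
proof -
  define r where "r = (\<lambda>k. s (int k) / (fact (n - k) * fact k))"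
  define P where "P = (\<Sum>k\<le>n. monom (r k) k)"
  have "P = 0"
  proof (rule poly_eq_off_finite[of "{1}"])
    fix t :: complex assume "t \<notin> {1}"
    then have t: "1 - t \<noteq> 0" by auto
    define x where "x = (z2 - t * z1) / (1 - t)"
    have X: "x - z1 = (z2 - z1) / (1 - t)" and Y: "x - z2 = t * (x - z1)"
      using t by (simp_all add: x_def field_simps)
    then have X0: "x - z1 \<noteq> 0" using t assms by auto
    have "0 = poly (binary_form z1 z2 n s) x" using assms by simp
    also have "\<dots> = (\<Sum>k\<le>n. r k * ((x - z1) ^ (n - k) * (t * (x - z1)) ^ k))"
      by (simp add: binary_form_def binary_monomial_def poly_sum Y[symmetric] r_def)
    also have "\<dots> = (\<Sum>k\<le>n. (x - z1) ^ n * (r k * t ^ k))"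
    proof (rule sum.cong)
      fix k assume "k \<in> {..n}"
      then have "(x - z1) ^ n = (x - z1) ^ (n - k) * (x - z1) ^ k"
        by (simp add: power_add[symmetric])
      then show "r k * ((x - z1) ^ (n - k) * (t * (x - z1)) ^ k) = (x - z1) ^ n * (r k * t ^ k)"
        by (simp add: power_mult_distrib)
    qed simp
    also have "\<dots> = (x - z1) ^ n * poly P t"
      by (simp add: P_def poly_sum poly_monom sum_distrib_left)
    finally show "poly P t = poly 0 t" using X0 by simp
  qed simp
  then have "coeff P k = 0" by simp
  moreover have "coeff P k = r k" using assms(3) by (simp add: P_def coeff_sum)
  ultimately show ?thesis by (simp add: r_def)
qed

section \<open>Solutions of the recurrence\<close>

text \<open>
  The end coefficients of a binary form are, up to nonzero factors, its values at \<open>z2\<close> and \<open>z1\<close>. All polynomial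
  solutions are multiples of \<open>p\<close>, which vanishes at neither point, so one vanishing end kills the solution.
\<close>
lemma heun_solution_end_zero:
  assumes p: "heun m1 m2 z1 z2 n dl h p = 0" "poly p z1 \<noteq> 0" "poly p z2 \<noteq> 0"
    and z: "z1 \<noteq> z2" and dl: "dl \<notin> \<int>"
    and s: "\<And>k. k \<in> {0..int n} \<Longrightarrow> tridiag m1 m2 z1 z2 n dl h s k = 0"
    and e: "s 0 = 0 \<or> s (int n) = 0" and k: "k \<in> {0..int n}"
  shows "s k = 0"
proof -
  have "binary_form z1 z2 n (tridiag m1 m2 z1 z2 n dl h s) = 0"
    unfolding binary_form_def by (rule sum.neutral) (simp add: s)
  then have "heun m1 m2 z1 z2 n dl h (binary_form z1 z2 n s) = 0"
    by (simp add: heun_binary_form)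
  moreover have "p \<noteq> 0" using p(2) by auto
  ultimately obtain a where a: "binary_form z1 z2 n s = smult a p"
    using heun_unique[OF _ p(1) dl] by blast
  have "poly (binary_form z1 z2 n s) z1 = (\<Sum>k\<le>n. if k = n then s (int n) * (z1 - z2) ^ n / fact n else 0)"
    unfolding binary_form_def poly_sum
    by (rule sum.cong) (auto simp: binary_monomial_def power_0_left)
  moreover have "poly (binary_form z1 z2 n s) z2 = (\<Sum>k\<le>n. if k = 0 then s 0 * (z2 - z1) ^ n / fact n else 0)"
    unfolding binary_form_def poly_sum
    by (rule sum.cong) (auto simp: binary_monomial_def power_0_left)
  ultimately have "a * poly p z1 = 0 \<or> a * poly p z2 = 0"
    using e by (auto simp: a)
  then have "binary_form z1 z2 n s = 0" using p a by auto
  from binary_form_eq_0[OF z this, of "nat k"] show ?thesis using k by auto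
qed

text \<open>
  The recurrence for degree \<open>n1\<close> and parameter \<open>- dl\<close> becomes the one for degree \<open>n2\<close> and parameter \<open>dl\<close> when the
  index is reflected and the sequence rescaled by powers of \<open>z1 / z2\<close>. This is why the coefficients of \<open>p1\<close>
  appear in the comparison with reflected index and with such a power.
\<close>
lemma tridiag_reflect:
  assumes z: "z1 \<noteq> 0" "z2 \<noteq> 0" and n: "n1 + n2 = m1 + m2"
  shows "tridiag m1 m2 z1 z2 n2 dl (h - dl * (of_nat m1 * z2 + of_nat m2 * z1))
           (\<lambda>i. t (int m2 - i) * (z1 / z2) powi i) i =
         (z1 / z2) powi i * tridiag m1 m2 z1 z2 n1 (- dl) h t (int m2 - i)"
proof -
  have n1: "int n1 = int m1 + int m2 - int n2" using n by linarith
  define r where "r = (z1 / z2) powi i"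
  have p: "(z1 / z2) powi (i - 1) = r * z2 / z1" "(z1 / z2) powi (i + 1) = r * z1 / z2"
    using z by (simp_all add: r_def power_int_diff power_int_add)
  have a: "int m2 - (i - 1) = int m2 - i + 1" "int m2 - (i + 1) = int m2 - i - 1" by auto
  show ?thesis
    unfolding tridiag_def n1 p a r_def[symmetric] using z by (simp add: algebra_simps)
qed

lemma tridiag_linear:
  "tridiag m1 m2 z1 z2 n dl h (\<lambda>i. a * s i - b * t i) k =
     a * tridiag m1 m2 z1 z2 n dl h s k - b * tridiag m1 m2 z1 z2 n dl h t k"
  by (simp add: tridiag_def algebra_simps)

text \<open>
  Between \<open>\<alpha>\<close> and \<open>\<beta>\<close> the recurrence closes up: at \<open>\<alpha>\<close> the coefficient of \<open>s (\<alpha> - 1)\<close> is zero, and that of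
  \<open>s (k + 1)\<close> stays nonzero before \<open>\<beta>\<close>. So the value at \<open>\<alpha>\<close> determines the rest.
\<close>
lemma tridiag_core:
  fixes n m1 m2 :: nat
  defines "\<alpha> \<equiv> max 0 (int n - int m1)" and "\<beta> \<equiv> min (int n) (int m2)"
  assumes z: "z2 \<noteq> 0"
    and s: "\<And>i. i \<in> {\<alpha>..\<beta>} \<Longrightarrow> tridiag m1 m2 z1 z2 n dl h s i = 0"
    and s0: "s \<alpha> = 0" and i: "i \<in> {\<alpha>..\<beta>}"
  shows "s i = 0"
proof -
  have "\<alpha> \<le> i" using i by auto
  then have "i \<le> \<beta> \<longrightarrow> s i = 0 \<and> (i = \<alpha> \<or> s (i - 1) = 0)"
  proof (induction rule: int_ge_induct)
    case base
    then show ?case using s0 by auto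
  next
    case (step i)
    show ?case
    proof
      assume le: "i + 1 \<le> \<beta>"
      then have si: "s i = 0" "i = \<alpha> \<or> s (i - 1) = 0" and "i \<in> {\<alpha>..\<beta>}"
        using step by auto
      have "\<alpha> * (int m1 - int n + \<alpha>) = 0" by (auto simp: \<alpha>_def max_def)
      then have "i * (int m1 - int n + i) = 0 \<or> s (i - 1) = 0" using si(2) by auto
      then have e: "of_int (i * (int m1 - int n + i)) * s (i - 1) = 0" by (metis mult_zero_left mult_zero_right of_int_0)
      have "z2 * of_int ((int n - i) * (int m2 - i)) * s (i + 1) = 0"
        using s[OF \<open>i \<in> {\<alpha>..\<beta>}\<close>] unfolding tridiag_def mult.assoc
        by (simp only: e si(1) mult_zero_right add_0_left add_0_right)
      moreover have "of_int ((int n - i) * (int m2 - i)) \<noteq> (0::complex)"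
        using le unfolding of_int_eq_0_iff by (auto simp: \<beta>_def)
      ultimately have "s (i + 1) = 0" using z by simp
      then show "s (i + 1) = 0 \<and> (i + 1 = \<alpha> \<or> s (i + 1 - 1) = 0)" using si by simp
    qed
  qed
  then show ?thesis using i by auto
qed

text \<open>
  A solution that vanishes at \<open>\<alpha>\<close> vanishes on \<open>{\<alpha>..\<beta>}\<close>. What is left to the left of \<open>\<alpha>\<close> and what is left to the
  right of \<open>\<beta>\<close> are then separate solutions, since they do not see each other, and each of them extends by zero
  to one of the ranges \<open>{0..n}\<close> and \<open>{n - m1..m2}\<close>, where it has a zero at an end. The hypotheses \<open>c\<close> and \<open>d\<close>
  say that solutions with a zero at an end of these ranges are trivial.
\<close>
lemma tridiag_vanish:
  fixes n m1 m2 :: nat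
  defines "\<alpha> \<equiv> max 0 (int n - int m1)" and "\<beta> \<equiv> min (int n) (int m2)"
  assumes z: "z2 \<noteq> 0" and nm: "n \<le> m1 + m2"
    and c: "\<And>s i. (\<And>k. k \<in> {0..int n} \<Longrightarrow> tridiag m1 m2 z1 z2 n dl h s k = 0)
              \<Longrightarrow> s 0 = 0 \<or> s (int n) = 0 \<Longrightarrow> i \<in> {0..int n} \<Longrightarrow> s i = 0"
    and d: "\<And>s i. (\<And>k. k \<in> {int n - int m1..int m2} \<Longrightarrow> tridiag m1 m2 z1 z2 n dl h s k = 0)
              \<Longrightarrow> s (int n - int m1) = 0 \<or> s (int m2) = 0 \<Longrightarrow> i \<in> {int n - int m1..int m2} \<Longrightarrow> s i = 0"
    and lo: "lo = 0 \<or> lo = int n - int m1" and hi: "hi = int n \<or> hi = int m2"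
    and s: "\<And>i. i \<in> {lo..hi} \<Longrightarrow> tridiag m1 m2 z1 z2 n dl h s i = 0"
    and s0: "s \<alpha> = 0" and i: "i \<in> {lo..hi}"
  shows "s i = 0"
proof -
  have ord: "lo \<le> \<alpha>" "\<alpha> \<le> \<beta>" "\<beta> \<le> hi" using lo hi nm by (auto simp: \<alpha>_def \<beta>_def)
  have core: "s j = 0" if "j \<in> {\<alpha>..\<beta>}" for j
    using tridiag_core[OF z, where s = s and n = n and ?m1.0 = m1 and ?m2.0 = m2] s s0 that ord
    unfolding \<alpha>_def \<beta>_def by (meson atLeastAtMost_iff order_trans)
  \<comment> \<open>The part to the left of \<open>\<alpha>\<close>: the recurrence at \<open>\<alpha>\<close> itself holds because its lower coefficient is zero.\<close>
  define t where "t = (\<lambda>j. if j < \<alpha> then s j else 0)"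
  have t: "tridiag m1 m2 z1 z2 n dl h t j = 0" if "lo \<le> j" for j
  proof -
    consider "j < \<alpha>" | "j = \<alpha>" | "j > \<alpha>" by linarith
    then show ?thesis
    proof cases
      case 1
      then have "t (j - 1) = s (j - 1)" "t j = s j" "t (j + 1) = s (j + 1)"
        using s0 by (auto simp: t_def) (metis add.commute zless_imp_add1_zle order_antisym_conv not_less)
      then show ?thesis using s[of j] that 1 ord by (simp add: tridiag_def)
    next
      case 2
      then have "j * (int m1 - int n + j) = 0" by (auto simp: \<alpha>_def max_def)
      then have "of_int (j * (int m1 - int n + j)) = (0::complex)" by (simp only: of_int_0)
      then show ?thesis using 2 unfolding tridiag_def by (simp add: t_def del: of_int_mult)
    next
      case 3
      then show ?thesis by (simp add: tridiag_def t_def)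
    qed
  qed
  \<comment> \<open>The part to the right of \<open>\<beta>\<close>: at \<open>\<beta>\<close> the upper coefficient is zero.\<close>
  define t' where "t' = (\<lambda>j. if j > \<beta> then s j else 0)"
  have t': "tridiag m1 m2 z1 z2 n dl h t' j = 0" if "j \<le> hi" for j
  proof -
    consider "j > \<beta>" | "j = \<beta>" | "j < \<beta>" by linarith
    then show ?thesis
    proof cases
      case 1
      have "s \<beta> = 0" using core ord by auto
      then have "t' (j - 1) = s (j - 1)" "t' j = s j" "t' (j + 1) = s (j + 1)"
        using 1 by (cases "j - 1 = \<beta>"; auto simp: t'_def)+
      then show ?thesis using s[of j] that 1 ord by (simp add: tridiag_def)
    next
      case 2
      then have "(int n - j) * (int m2 - j) = 0" by (auto simp: \<beta>_def min_def)
      then have "of_int ((int n - j) * (int m2 - j)) = (0::complex)" by (simp only: of_int_0)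
      then show ?thesis using 2 unfolding tridiag_def by (simp add: t'_def del: of_int_mult)
    next
      case 3
      then show ?thesis by (simp add: tridiag_def t'_def)
    qed
  qed
  consider "i < \<alpha>" | "i \<in> {\<alpha>..\<beta>}" | "i > \<beta>" by fastforce
  then show ?thesis
  proof cases
    case 1
    have "t i = 0"
    proof (cases "lo = 0")
      case True
      have "t (int n) = 0" using ord by (auto simp: t_def \<beta>_def)
      then show ?thesis using c[of t i] t True i 1 ord by (auto simp: \<beta>_def)
    next
      case False
      then have "lo = int n - int m1" using lo by auto
      moreover have "t (int m2) = 0" using ord by (auto simp: t_def \<beta>_def)
      ultimately show ?thesis using d[of t i] t i 1 ord by (auto simp: \<beta>_def)
    qed
    then show ?thesis using 1 by (simp add: t_def)
  next
    case 3
    have "t' i = 0"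
    proof (cases "hi = int n")
      case True
      have "t' 0 = 0" using ord by (auto simp: t'_def \<alpha>_def)
      then show ?thesis using c[of t' i] t' True i 3 ord by (auto simp: \<alpha>_def)
    next
      case False
      then have "hi = int m2" using hi by auto
      moreover have "t' (int n - int m1) = 0" using ord by (auto simp: t'_def \<alpha>_def)
      ultimately show ?thesis using d[of t' i] t' i 3 ord by (auto simp: \<alpha>_def)
    qed
    then show ?thesis using 3 by (simp add: t'_def)
  qed (rule core)
qed

section \<open>Difference equations in a basis of factorial products\<close>

definition rising_falling :: "nat \<Rightarrow> nat \<Rightarrow> complex \<Rightarrow> complex \<Rightarrow> complex" where
  "rising_falling m k a b =
     1 / (fact (m - k) * fact k) * (\<Prod>j<m - k. a + of_nat j) * (\<Prod>j<k. b - of_nat j)"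

lemma falling_shift:
  fixes b :: complex
  shows "b * (\<Prod>j<k. b - 1 - of_nat j) = (b - of_nat k) * (\<Prod>j<k. b - of_nat j)"
proof -
  have "b * (\<Prod>j<k. b - 1 - of_nat j) = (\<Prod>j<Suc k. b - of_nat j)"
    by (simp add: prod.lessThan_Suc_shift o_def algebra_simps del: prod.lessThan_Suc)
  then show ?thesis by (simp add: mult.commute)
qed

lemma rising_shift:
  fixes a :: complex
  shows "a * (\<Prod>j<k. a + 1 + of_nat j) = (a + of_nat k) * (\<Prod>j<k. a + of_nat j)"
proof -
  have "a * (\<Prod>j<k. a + 1 + of_nat j) = (\<Prod>j<Suc k. a + of_nat j)"
    by (simp add: prod.lessThan_Suc_shift o_def algebra_simps del: prod.lessThan_Suc)
  then show ?thesis by (simp add: mult.commute)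
qed

text \<open>
  Multiplication by \<open>b\<close> turns the falling product at \<open>b - 1\<close> into \<open>b - k\<close> times the one at \<open>b\<close>. In the rising
  product with \<open>M = m - k\<close> factors, \<open>a - 1\<close> replaces the last factor \<open>a + M - 1\<close>, and
  \<open>(a - 1) * (a + n1) = (a + M - 1) * (a + n1 - M) - M * (n1 - M + 1)\<close>; the constant yields the element with
  index \<open>k + 1\<close>.
\<close>
lemma rising_falling_down:
  assumes k: "k \<le> m"
  shows "(a + of_nat n1) * b * rising_falling m k (a - 1) (b - 1) =
    - (of_nat n1 - of_nat m + of_nat k + 1) *
        (if k < m then of_nat (Suc k) * rising_falling m (Suc k) a b else 0)
    + (b - of_nat k) * (a + of_nat n1 - of_nat m + of_nat k) * rising_falling m k a b"
proof -
  define F where "F = (\<Prod>j<k. b - of_nat j)"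
  define c where "c = (1 / (fact (m - k) * fact k) :: complex)"
  have F: "b * (\<Prod>j<k. b - 1 - of_nat j) = (b - of_nat k) * F"
    by (simp add: F_def falling_shift)
  show ?thesis
  proof (cases "k < m")
    case False
    then have [simp]: "k = m" using k by simp
    have "(a + of_nat n1) * b * rising_falling m k (a - 1) (b - 1) =
       c * (a + of_nat n1) * (b * (\<Prod>j<k. b - 1 - of_nat j))"
      by (simp add: rising_falling_def c_def mult_ac)
    then show ?thesis unfolding F by (simp add: rising_falling_def c_def F_def)
  next
    case True
    define r where "r = m - Suc k"
    have r: "m - k = Suc r" "m - Suc k = r" "of_nat m = of_nat k + of_nat r + (1::complex)"
      using True by (auto simp: r_def of_nat_diff)
    define P where "P = (\<Prod>j<r. a + of_nat j)"
    have "(\<Prod>j<Suc r. a - 1 + of_nat j) = (a - 1) * P"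
      by (simp add: prod.lessThan_Suc_shift P_def o_def algebra_simps del: prod.lessThan_Suc)
    then have "(a + of_nat n1) * b * rising_falling m k (a - 1) (b - 1) =
       c * (a + of_nat n1) * ((a - 1) * P) * (b * (\<Prod>j<k. b - 1 - of_nat j))"
      by (simp only: rising_falling_def c_def r mult_ac)
    also have "\<dots> = c * (a + of_nat n1) * ((a - 1) * P) * ((b - of_nat k) * F)"
      by (simp only: F)
    finally have 1: "(a + of_nat n1) * b * rising_falling m k (a - 1) (b - 1) =
       c * (a + of_nat n1) * ((a - 1) * P) * ((b - of_nat k) * F)" .
    have 2: "rising_falling m k a b = c * (P * (a + of_nat r)) * F"
      by (simp add: rising_falling_def c_def r P_def F_def)
    have 3: "of_nat (Suc k) * rising_falling m (Suc k) a b = c * of_nat (Suc r) * P * (F * (b - of_nat k))"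
      unfolding rising_falling_def c_def r P_def[symmetric] prod.lessThan_Suc F_def[symmetric]
      by (simp add: divide_simps del: of_nat_Suc)
    show ?thesis using True unfolding 1 2 3 r(3) by (simp add: algebra_simps)
  qed
qed

text \<open>
  The mirror image of the preceding lemma, from \<open>(b + 1) * (b - n2) = (b - k + 1) * (b - n2 + k) - k * (n2 - k + 1)\<close>;
  the constant now yields the element with index \<open>k - 1\<close>.
\<close>
lemma rising_falling_up:
  assumes k: "k \<le> m"
  shows "a * (b - of_nat n2) * rising_falling m k (a + 1) (b + 1) =
    - (of_nat n2 - of_nat k + 1) *
        (if k > 0 then of_nat (Suc m - k) * rising_falling m (k - 1) a b else 0)
    + (a + of_nat m - of_nat k) * (b - of_nat n2 + of_nat k) * rising_falling m k a b"
proof -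
  define P where "P = (\<Prod>j<m - k. a + of_nat j)"
  define c where "c = (1 / (fact (m - k) * fact k) :: complex)"
  have mk: "of_nat (m - k) = of_nat m - (of_nat k :: complex)" using k by (simp add: of_nat_diff)
  have P: "a * (\<Prod>j<m - k. a + 1 + of_nat j) = (a + of_nat m - of_nat k) * P"
    by (simp add: P_def rising_shift mk)
  show ?thesis
  proof (cases k)
    case 0
    have "a * (b - of_nat n2) * rising_falling m k (a + 1) (b + 1) =
       c * (b - of_nat n2) * (a * (\<Prod>j<m - k. a + 1 + of_nat j))"
      by (simp add: rising_falling_def c_def 0 mult_ac)
    then show ?thesis unfolding P by (simp add: rising_falling_def c_def P_def 0)
  next
    case (Suc r)
    have r: "k - 1 = r" "Suc m - k = Suc (m - k)" "m - r = Suc (m - k)" using k Suc by auto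
    define F where "F = (\<Prod>j<r. b - of_nat j)"
    have "(\<Prod>j<k. b + 1 - of_nat j) = (b + 1) * F"
      by (simp add: Suc prod.lessThan_Suc_shift F_def o_def algebra_simps del: prod.lessThan_Suc)
    then have "a * (b - of_nat n2) * rising_falling m k (a + 1) (b + 1) =
       c * (b - of_nat n2) * ((b + 1) * F) * (a * (\<Prod>j<m - k. a + 1 + of_nat j))"
      by (simp only: rising_falling_def c_def mult_ac)
    also have "\<dots> = c * (b - of_nat n2) * ((b + 1) * F) * ((a + of_nat m - of_nat k) * P)"
      by (simp only: P)
    finally have 1: "a * (b - of_nat n2) * rising_falling m k (a + 1) (b + 1) =
       c * (b - of_nat n2) * ((b + 1) * F) * ((a + of_nat m - of_nat k) * P)" .
    have 2: "rising_falling m k a b = c * P * (F * (b - of_nat r))"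
      by (simp add: rising_falling_def c_def P_def F_def Suc)
    have 3: "of_nat (Suc m - k) * rising_falling m (k - 1) a b =
        c * of_nat k * (P * (a + of_nat m - of_nat k)) * F"
      unfolding rising_falling_def c_def r prod.lessThan_Suc F_def[symmetric] P_def[symmetric] mk
      by (simp add: Suc divide_simps del: of_nat_Suc)
    have k1: "of_nat k = of_nat r + (1::complex)" by (simp add: Suc)
    show ?thesis using Suc unfolding 1 2 3 k1 by (simp add: algebra_simps)
  qed
qed

text \<open>
  At \<open>b = k\<close> all elements with index larger than \<open>k\<close> vanish, and the one with index \<open>k\<close> does not, because \<open>l\<close>
  is no integer. So the coefficients vanish one after the other.
\<close>
lemma rising_falling_independent:
  assumes l: "l \<notin> \<int>" and 0: "\<And>b. (\<Sum>k\<le>m. r k * rising_falling m k (b + l) b) = 0" and k: "k \<le> m"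
  shows "r k = 0"
  using k
proof (induction k rule: less_induct)
  case (less k)
  have "(\<Sum>j\<le>m. r j * rising_falling m j (of_nat k + l) (of_nat k)) =
      (\<Sum>j\<le>m. if j = k then r k * rising_falling m k (of_nat k + l) (of_nat k) else 0)"
  proof (rule sum.cong)
    fix j assume "j \<in> {..m}"
    have "j < k \<Longrightarrow> r j = 0" using less by auto
    moreover have "(\<Prod>i<j. of_nat k - of_nat i :: complex) = 0" if "k < j"
      using that by (intro prod_zero) auto
    ultimately show "r j * rising_falling m j (of_nat k + l) (of_nat k) =
        (if j = k then r k * rising_falling m k (of_nat k + l) (of_nat k) else 0)"
      by (auto simp: rising_falling_def not_less_iff_gr_or_eq)
  qed simp
  then have "r k * rising_falling m k (of_nat k + l) (of_nat k) = 0" using 0 less by simp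
  moreover have "(\<Prod>j<m - k. of_nat k + l + of_nat j) \<noteq> 0"
  proof -
    have "of_nat k + l + of_nat j \<noteq> 0" for j
    proof
      assume "of_nat k + l + of_nat j = 0"
      then have "l = - (of_nat k + of_nat j)"
        unfolding eq_neg_iff_add_eq_0 by (simp add: ac_simps)
      then have "l = of_int (- (int k + int j))" by simp
      then show False using l by (metis Ints_of_int)
    qed
    then show ?thesis by simp
  qed
  moreover have "(\<Prod>j<k. of_nat k - of_nat j :: complex) \<noteq> 0" by simp
  ultimately show ?case by (simp add: rising_falling_def)
qed

text \<open>
  Each of the two outer terms of the equation produces one neighbour of a basis element and a multiple of the
  element itself, by a quadratic polynomial in \<open>u\<close>. The condition on \<open>T\<close> says that these polynomials add up with
  \<open>T\<close> to a constant, so that the equation becomes a three-term recurrence with constant coefficients.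
\<close>
lemma difference_equation_recurrence:
  fixes s D :: "int \<Rightarrow> complex"
  assumes l: "l1 - l2 \<notin> \<int>"
    and q: "\<And>u. q u = (\<Sum>k\<le>m. s (int k) * rising_falling m k (u - l1 - 1 - of_nat n1) (u - l2 - 1))"
    and eq: "\<And>u. za * (u - l1) * (u - l2) * q u + T u * q (u + 1)
               + zb * (u - l1 - of_nat n1) * (u - l2 - of_nat n2) * q (u + 2) = 0"
    and D: "\<And>u k. T u + za * (u - l2 - of_int k) * (u - l1 - of_nat m + of_int k)
               + zb * (u - l1 - of_nat n1 + of_nat m - of_int k) * (u - l2 - of_nat n2 + of_int k) = D k"
    and k: "k \<in> {0..int m}"
  shows "za * of_int (k * (int n1 - int m + k)) * s (k - 1)
       + zb * of_int ((int m - k) * (int n2 - k)) * s (k + 1) = D k * s k"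
proof -
  define A where "A = (\<lambda>k::int. - za * (of_nat n1 - of_nat m + of_int k + 1))"
  define B where "B = (\<lambda>k::int. - zb * (of_nat n2 - of_int k + 1))"
  define r where "r = (\<lambda>k. of_nat k * A (int k - 1) * s (int k - 1)
      + of_nat (m - k) * B (int k + 1) * s (int k + 1) + D (int k) * s (int k))"
  have "r (nat k) = 0"
  proof (rule rising_falling_independent)
    show "l2 - l1 - of_nat n1 \<notin> \<int>"
    proof
      assume "l2 - l1 - of_nat n1 \<in> \<int>"
      then have "- (l2 - l1 - of_nat n1 + of_nat n1) \<in> \<int>" by (intro Ints_minus Ints_add) auto
      then show False using l by simp
    qed
    show "nat k \<le> m" using k by auto
    fix b
    define u where "u = b + l2"
    define a where "a = b + (l2 - l1 - of_nat n1)"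
    define M where "M = (\<lambda>k. rising_falling m k a b)"
    have u: "u - l1 - 1 - of_nat n1 = a - 1" "u - l2 - 1 = b - 1"
      "u + 1 - l1 - 1 - of_nat n1 = a" "u + 1 - l2 - 1 = b"
      "u + 2 - l1 - 1 - of_nat n1 = a + 1" "u + 2 - l2 - 1 = b + 1"
      "u - l1 = a + of_nat n1" "u - l2 = b" "u - l1 - of_nat n1 = a" "u - l2 - of_nat n2 = b - of_nat n2"
      by (auto simp: u_def a_def)
    have "0 = za * (a + of_nat n1) * b * q u + T u * q (u + 1) + zb * a * (b - of_nat n2) * q (u + 2)"
      using eq[of u] unfolding u by simp
    also have "\<dots> = (\<Sum>k\<le>m. s (int k) * (za * ((a + of_nat n1) * b * rising_falling m k (a - 1) (b - 1))
       + T u * M k + zb * (a * (b - of_nat n2) * rising_falling m k (a + 1) (b + 1))))"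
      unfolding q u M_def sum_distrib_left sum.distrib[symmetric]
      by (intro sum.cong refl) (simp add: algebra_simps)
    also have "\<dots> = (\<Sum>k\<le>m. s (int k) * (A (int k) * (if k < m then of_nat (Suc k) * M (Suc k) else 0)
            + B (int k) * (if k > 0 then of_nat (Suc m - k) * M (k - 1) else 0) + D (int k) * M k))"
    proof (intro sum.cong refl arg_cong2[of _ _ _ _ "(*)"])
      fix k assume "k \<in> {..m}"
      then have k: "k \<le> m" by auto
      have D': "T u = D (int k) - za * (b - of_nat k) * (a + of_nat n1 - of_nat m + of_nat k)
          - zb * (a + of_nat m - of_nat k) * (b - of_nat n2 + of_nat k)"
        unfolding D[of u "int k", symmetric] u by (simp add: algebra_simps)
      show "za * ((a + of_nat n1) * b * rising_falling m k (a - 1) (b - 1))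
          + T u * M k + zb * (a * (b - of_nat n2) * rising_falling m k (a + 1) (b + 1)) =
          A (int k) * (if k < m then of_nat (Suc k) * M (Suc k) else 0)
            + B (int k) * (if k > 0 then of_nat (Suc m - k) * M (k - 1) else 0) + D (int k) * M k"
        unfolding rising_falling_down[OF k] rising_falling_up[OF k] D' M_def A_def B_def
        by (simp add: algebra_simps del: of_nat_Suc split del: if_split)
    qed
    also have "\<dots> = (\<Sum>k\<le>m. r k * M k)" unfolding sum_tridiagonal r_def ..
    finally show "(\<Sum>k\<le>m. r k * rising_falling m k (b + (l2 - l1 - of_nat n1)) b) = 0"
      by (simp add: M_def a_def)
  qed
  moreover obtain j where "k = int j" "j \<le> m" using k nonneg_int_cases[of k] by auto
  ultimately show ?thesis by (simp add: r_def A_def B_def algebra_simps of_nat_diff)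
qed

section \<open>The differential equation of a space of quasi-polynomials\<close>

text \<open>
  The Wronskian of \<open>x powr l1 * p\<close> and \<open>x powr l2 * q\<close> is \<open>x powr (l1 + l2 - 1)\<close> times this polynomial, for
  \<open>dl = l2 - l1\<close>.
\<close>
definition wronskian_poly :: "complex \<Rightarrow> complex poly \<Rightarrow> complex poly \<Rightarrow> complex poly" where
  "wronskian_poly dl p q = smult dl (p * q) + [:0, 1:] * (p * pderiv q - pderiv p * q)"

text \<open>
  A common root of \<open>p\<close> and \<open>q\<close> is a root of the Wronskian, hence \<open>z1\<close> or \<open>z2\<close>, where \<open>p\<close> does not vanish.
\<close>
lemma coprime_wronskian_poly:
  assumes W: "wronskian_poly dl p q = smult K ([:-z1, 1:] ^ m1 * [:-z2, 1:] ^ m2)"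
    and K: "K \<noteq> 0" and p: "poly p z1 \<noteq> 0" "poly p z2 \<noteq> 0"
  shows "coprime p q"
proof (rule coprimeI)
  fix g assume g: "g dvd p" "g dvd q"
  show "is_unit g"
  proof (rule ccontr)
    assume "\<not> is_unit g"
    moreover have "g \<noteq> 0" using g p by auto
    ultimately have "degree g \<noteq> 0" by (simp add: is_unit_iff_degree)
    then obtain r where "poly g r = 0" using alg_closed_imp_poly_has_root[of g] by auto
    then have r: "poly p r = 0" "poly q r = 0" using g by auto
    then have "poly (wronskian_poly dl p q) r = 0" by (simp add: wronskian_poly_def)
    then have "r = z1 \<or> r = z2" using K by (auto simp: W)
    then show False using r p by auto
  qed
qed

lemma wronskian_poly_log_deriv:
  fixes z1 z2 :: complex
  assumes W: "W = smult K ([:-z1, 1:] ^ m1 * [:-z2, 1:] ^ m2)"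
  shows "[:-z1, 1:] * [:-z2, 1:] * pderiv W =
    (smult (of_nat m1) [:-z2, 1:] + smult (of_nat m2) [:-z1, 1:]) * W"
proof -
  have d: "[:-a, 1:] * pderiv ([:-a, 1:] ^ m) = smult (of_nat m) ([:-a, 1:] ^ m)" for a :: complex and m
  proof (cases m)
    case (Suc j)
    then show ?thesis by (simp add: pderiv_power_Suc pderiv_pCons del: mult_pCons_left power_Suc)
        (simp del: mult_pCons_left)
  qed simp
  define A where "A = [:-z1, 1:]"
  define B where "B = [:-z2, 1:]"
  define P where "P = A ^ m1"
  define Q where "Q = B ^ m2"
  have P: "A * pderiv P = smult (of_nat m1) P" and Q: "B * pderiv Q = smult (of_nat m2) Q"
    unfolding P_def Q_def A_def B_def by (simp_all only: d)
  have "A * B * pderiv (P * Q) = B * (A * pderiv P) * Q + A * P * (B * pderiv Q)"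
    unfolding pderiv_mult by (simp only: algebra_simps)
  also have "\<dots> = (smult (of_nat m1) B + smult (of_nat m2) A) * (P * Q)"
    unfolding P Q by (simp add: algebra_simps)
  finally show ?thesis
    unfolding W A_def[symmetric] B_def[symmetric] P_def[symmetric] Q_def[symmetric]
    by (simp add: pderiv_smult)
qed

text \<open>
  In the second-order equation with solutions \<open>p1\<close> and \<open>x powr dl * p2\<close>, the logarithmic derivative of the
  Wronskian is the coefficient of the first derivative. Let \<open>E1\<close> and \<open>E2\<close> be what the terms with derivatives give for
  these two functions, up to powers of \<open>x\<close>. Then \<open>p1 * E2 = p2 * E1\<close>, and by coprimality \<open>E1\<close> and \<open>E2\<close> are the
  same multiple \<open>S\<close> of \<open>p1\<close> and \<open>p2\<close>. Comparing degrees, \<open>S\<close> has degree at most one and a known coefficient of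
  \<open>x\<close>; its constant term is the accessory parameter.
\<close>
lemma heun_equations:
  assumes n: "n1 + n2 = m1 + m2" and p: "degree p1 = n1" "poly p1 0 \<noteq> 0" "poly p1 z1 \<noteq> 0" "poly p1 z2 \<noteq> 0"
    and q: "p2 \<noteq> 0"
    and W: "wronskian_poly dl p1 p2 = smult K ([:-z1, 1:] ^ m1 * [:-z2, 1:] ^ m2)" "K \<noteq> 0"
  obtains h where "heun m1 m2 z1 z2 n1 (- dl) h p1 = 0"
    "heun m1 m2 z1 z2 n2 dl (h - dl * (of_nat m1 * z2 + of_nat m2 * z1)) p2 = 0"
proof -
  define XY where "XY = [:-z1, 1:] * [:-z2, 1:]"
  define G where "G = smult (of_nat m1) [:-z2, 1:] + smult (of_nat m2) [:-z1, 1:]"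
  define E1 where "E1 = XY * ([:0, 1:] * pderiv (pderiv p1) + smult (1 - dl) (pderiv p1))
     - [:0, 1:] * G * pderiv p1"
  define E2 where "E2 = XY * ([:0, 1:] * pderiv (pderiv p2) + smult (1 + dl) (pderiv p2))
     - [:0, 1:] * G * pderiv p2 - smult dl (G * p2)"
  define W where "W = wronskian_poly dl p1 p2"
  have dW: "pderiv W = smult dl (p1 * pderiv p2 + pderiv p1 * p2) + (p1 * pderiv p2 - pderiv p1 * p2)
      + [:0, 1:] * (p1 * pderiv (pderiv p2) - pderiv (pderiv p1) * p2)"
    by (simp add: W_def wronskian_poly_def pderiv_add pderiv_mult pderiv_smult pderiv_diff pderiv_pCons
        algebra_simps)
  define x where "x = [:0, 1 :: complex:]"
  have "p1 * E2 - p2 * E1 = XY * pderiv W - G * W"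
    unfolding dW E1_def E2_def unfolding W_def wronskian_poly_def x_def[symmetric]
    by (simp add: algebra_simps smult_add_left smult_diff_left smult_add_right smult_diff_right)
  also have "\<dots> = 0" using wronskian_poly_log_deriv[OF W(1)] by (simp add: W_def XY_def G_def)
  finally have eq: "p1 * E2 = p2 * E1" by simp
  have p1: "p1 \<noteq> 0" using p by auto
  define s where "s = of_nat n1 * (of_nat m1 + of_nat m2 - of_nat n1 + dl)"
  have H: "heun m1 m2 z1 z2 n1 (- dl) h p1 = E1 - [:h, - s:] * p1" for h
    unfolding heun_def E1_def XY_def G_def s_def by simp
  have "coprime p1 p2" using coprime_wronskian_poly W p by blast
  moreover have "p1 dvd p2 * E1" using eq by (metis dvd_triv_left)
  ultimately have "p1 dvd E1" by (simp add: coprime_dvd_mult_right_iff)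
  then have "p1 dvd heun m1 m2 z1 z2 n1 (- dl) 0 p1" unfolding H by (intro dvd_diff dvd_triv_right)
  then obtain R where R: "heun m1 m2 z1 z2 n1 (- dl) 0 p1 = p1 * R" by blast
  have "degree (p1 * R) \<le> n1" using degree_heun_le[OF p(1)] R by metis
  then have "degree R = 0" using p1 p(1) by (cases "R = 0") (auto simp: degree_mult_eq)
  then obtain h where h: "R = [:h:]" using degree_eq_zeroE by blast
  define S where "S = [:h, - s:]"
  have S: "E1 = p1 * S" using R unfolding H h S_def by (simp add: algebra_simps)
  then have S2: "E2 = p2 * S" using eq p1 by simp
  show ?thesis
  proof (rule that[of h])
    have c: "of_nat n1 + of_nat n2 = of_nat m1 + (of_nat m2 :: complex)" using n by (metis of_nat_add)
    then have n2: "of_nat n2 = of_nat m1 + of_nat m2 - (of_nat n1 :: complex)" by (simp add: algebra_simps)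
    show "heun m1 m2 z1 z2 n1 (- dl) h p1 = 0"
      unfolding H S S_def by simp
    have "heun m1 m2 z1 z2 n2 dl (h - dl * (of_nat m1 * z2 + of_nat m2 * z1)) p2 =
       E2 + smult dl (G * p2) - [:h - dl * (of_nat m1 * z2 + of_nat m2 * z1),
         - of_nat n2 * (of_nat m1 + of_nat m2 - of_nat n2 - dl):] * p2"
      unfolding heun_def E2_def XY_def G_def by (simp only: diff_add_cancel)
    also have "\<dots> = (S + smult dl G - [:h - dl * (of_nat m1 * z2 + of_nat m2 * z1),
         - of_nat n2 * (of_nat m1 + of_nat m2 - of_nat n2 - dl):]) * p2"
      unfolding S2 by (simp add: algebra_simps del: mult_pCons_left mult_pCons_right)
    also have "S + smult dl G - [:h - dl * (of_nat m1 * z2 + of_nat m2 * z1),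
         - of_nat n2 * (of_nat m1 + of_nat m2 - of_nat n2 - dl):] = 0"
      unfolding S_def s_def G_def n2 by (simp add: algebra_simps)
    finally show "heun m1 m2 z1 z2 n2 dl (h - dl * (of_nat m1 * z2 + of_nat m2 * z1)) p2 = 0"
      by simp
  qed
qed

section \<open>The Wronskian from the exponents\<close>

definition branch :: "complex \<Rightarrow> complex poly \<Rightarrow> complex \<Rightarrow> complex \<Rightarrow> complex" where
  "branch l p w x = exp (l * ln_branch w x) * poly p x"

text \<open>
  The conjugate of \<open>x * d / dx\<close> by \<open>x powr l\<close>.
\<close>
definition euler :: "complex \<Rightarrow> complex poly \<Rightarrow> complex poly" where
  "euler l p = smult l p + [:0, 1:] * pderiv p"

lemma cfun_span_2: "f \<in> cfun.span {a, b} \<longleftrightarrow> (\<exists>\<alpha> \<beta>. f = (\<lambda>x. \<alpha> * a x + \<beta> * b x))"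
  unfolding cfun.span_breakdown_eq[of f a] cfun.span_breakdown_eq[of _ b "{}"]
  by (auto simp: cscale_def fun_eq_iff algebra_simps)

lemma in_quasi_polynomials:
  "f \<in> quasi_polynomials l1 p1 l2 p2 w \<longleftrightarrow>
     (\<exists>\<alpha> \<beta>. f = (\<lambda>x. \<alpha> * branch l1 p1 w x + \<beta> * branch l2 p2 w x))"
  unfolding quasi_polynomials_def cfun_span_2 branch_def ..

lemma ln_branch:
  assumes x: "x \<in> ball (exp w) (norm (exp w))"
  shows "x \<noteq> 0" "exp (ln_branch w x) = x" "(ln_branch w has_field_derivative 1 / x) (at x)"
proof -
  show 0: "x \<noteq> 0" using x by (auto simp: dist_norm)
  then show "exp (ln_branch w x) = x" by (simp add: ln_branch_def exp_add)
  have "norm (x / exp w - 1) < 1"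
  proof -
    have "x / exp w - 1 = (x - exp w) / exp w" by (simp add: diff_divide_distrib)
    then have "norm (x / exp w - 1) = norm (x - exp w) / norm (exp w)" by (simp add: norm_divide)
    moreover have "norm (x - exp w) < norm (exp w)" using x by (simp only: mem_ball dist_norm norm_minus_commute)
    ultimately show ?thesis by (metis divide_less_eq_1_pos zero_less_norm_iff exp_not_eq_zero)
  qed
  then have "\<bar>Re (x / exp w - 1)\<bar> < 1" using abs_Re_le_cmod order_le_less_trans by blast
  then have "x / exp w \<notin> \<real>\<^sub>\<le>\<^sub>0" by (auto simp: complex_nonpos_Reals_iff)
  then show "(ln_branch w has_field_derivative 1 / x) (at x)"
    unfolding ln_branch_def using 0 by (auto intro!: derivative_eq_intros)
qed

lemma branch_has_derivative:
  assumes x: "x \<in> ball (exp w) (norm (exp w))"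
  shows "(branch l p w has_field_derivative branch l (euler l p) w x / x) (at x)"
proof -
  have "E * (l * (1 / x)) * P + P' * E = E * (l * P + x * P') / x" for E P P'
    using ln_branch(1)[OF x] by (simp add: field_simps)
  note eq = this[of "exp (l * ln_branch w x)" "poly p x" "poly (pderiv p) x"]
  have "((\<lambda>x. exp (l * ln_branch w x) * poly p x) has_field_derivative
      exp (l * ln_branch w x) * (l * (1 / x)) * poly p x + poly (pderiv p) x * exp (l * ln_branch w x)) (at x)"
    by (rule derivative_eq_intros refl ln_branch(3)[OF x] poly_DERIV)+ (simp add: mult_ac)
  then show ?thesis unfolding eq by (simp add: branch_def[abs_def] euler_def)
qed

lemma branch_wronskian:
  "branch l1 p1 w x * branch l2 (euler l2 p2) w x - branch l1 (euler l1 p1) w x * branch l2 p2 w x =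
     exp ((l1 + l2) * ln_branch w x) * poly (wronskian_poly (l2 - l1) p1 p2) x"
  by (simp add: branch_def euler_def wronskian_poly_def exp_add algebra_simps)

lemma linear_power_dvd:
  fixes W :: "complex poly"
  assumes W: "W \<noteq> 0" and eq: "\<forall>\<^sub>F x in at z. poly W x = (x - z) ^ m * H x" and H: "isCont H z"
  shows "[:-z, 1:] ^ m dvd W"
proof (rule ccontr)
  assume "\<not> ?thesis"
  then have lt: "order z W < m" by (simp add: order_divides W)
  obtain R where R: "W = [:-z, 1:] ^ order z W * R" "\<not> [:-z, 1:] dvd R"
    using order_decomp[OF W] by blast
  define k where "k = m - order z W"
  have "\<forall>\<^sub>F x in at z. (x - z) ^ k * H x = poly R x"
    using eq eventually_neq_at_within[of z z UNIV]
  proof (eventually_elim)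
    case (elim x)
    have "(x - z) ^ order z W * poly R x = (x - z) ^ order z W * ((x - z) ^ k * H x)"
    proof -
      have "(x - z) ^ order z W * poly R x = poly W x" by (subst R(1)) simp
      also have "\<dots> = (x - z) ^ (order z W + k) * H x" using elim lt by (simp add: k_def)
      finally show ?thesis by (simp add: power_add mult.assoc)
    qed
    then show ?case using elim by simp
  qed
  moreover have "((\<lambda>x. (x - z) ^ k * H x) \<longlongrightarrow> (z - z) ^ k * H z) (at z)"
    using H by (intro tendsto_intros) (auto simp: isCont_def)
  ultimately have "(poly R \<longlongrightarrow> (z - z) ^ k * H z) (at z)"
    using Lim_transform_eventually by blast
  moreover have "(poly R \<longlongrightarrow> poly R z) (at z)"
    using poly_isCont[of z R] by (simp add: isCont_def)
  ultimately have "poly R z = (z - z) ^ k * H z" using LIM_unique by blast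
  then have "poly R z = 0" using lt by (simp add: k_def power_0_left)
  then show False using R(2) by (simp add: poly_eq_0_iff_dvd)
qed

text \<open>
  Some \<open>f = \<alpha> * b1 + \<beta> * b2\<close> vanishes to order \<open>m + 1\<close> at \<open>z\<close>, so its Wronskian with \<open>b2\<close> vanishes to order \<open>m\<close>.
  That Wronskian is \<open>\<alpha>\<close> times the one of \<open>b1\<close> and \<open>b2\<close>. Here \<open>\<alpha>\<close> is nonzero, for otherwise \<open>f\<close> is a multiple
  of \<open>b2\<close>, which does not vanish at \<open>z\<close>.
\<close>
lemma linear_power_dvd_wronskian_poly:
  assumes ex: "1 + int m \<in> exponents (quasi_polynomials l1 p1 l2 p2 w) (exp w)"
    and p2: "poly p2 (exp w) \<noteq> 0" and W0: "wronskian_poly (l2 - l1) p1 p2 \<noteq> 0"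
  shows "[:- exp w, 1:] ^ m dvd wronskian_poly (l2 - l1) p1 p2"
proof -
  define z where "z = exp w"
  define S where "S = ball z (norm z)"
  define b1 b2 c1 c2 where "b1 = branch l1 p1 w" and "b2 = branch l2 p2 w"
    and "c1 = branch l1 (euler l1 p1) w" and "c2 = branch l2 (euler l2 p2) w"
  define W where "W = wronskian_poly (l2 - l1) p1 p2"
  have S: "open S" "connected S" "z \<in> S" by (auto simp: S_def z_def)
  obtain f where "f \<in> quasi_polynomials l1 p1 l2 p2 w" "f \<noteq> 0" and zf: "zorder f z = 1 + int m"
    using ex unfolding exponents_def z_def by (elim imageE) auto
  then obtain \<alpha> \<beta> where f: "f = (\<lambda>x. \<alpha> * b1 x + \<beta> * b2 x)" and f0: "f \<noteq> 0"
    unfolding in_quasi_polynomials b1_def b2_def by blast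
  define t where "t = (\<lambda>x. \<alpha> * c1 x + \<beta> * c2 x)"
  have df: "(f has_field_derivative t x / x) (at x)" if "x \<in> S" for x
    unfolding f t_def b1_def b2_def c1_def c2_def
    using that by (auto intro!: derivative_eq_intros branch_has_derivative simp: S_def z_def add_divide_distrib mult.commute)
  then have hf: "f holomorphic_on S" using S holomorphic_on_open by blast
  have Weq: "f x * c2 x - t x * b2 x = \<alpha> * (exp ((l1 + l2) * ln_branch w x) * poly W x)" for x
    unfolding f t_def W_def branch_wronskian[symmetric] b1_def b2_def c1_def c2_def
    by (simp add: algebra_simps)
  have "\<alpha> \<noteq> 0"
  proof
    assume \<alpha>: "\<alpha> = 0"
    then have "\<beta> \<noteq> 0" using f f0 by (auto simp: fun_eq_iff)
    then have "f z \<noteq> 0" using p2 \<alpha> by (simp add: f b2_def branch_def z_def)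
    then have "zorder f z = 0" using S hf by (intro zorder_eqI[of S z f]) auto
    then show False using zf by simp
  qed
  \<comment> \<open>The order \<open>zorder f z\<close> is meaningful only if \<open>f\<close> does not vanish identically near \<open>z\<close>.\<close>
  have "\<exists>x\<in>S. f x \<noteq> 0"
  proof (rule ccontr)
    assume "\<not> ?thesis"
    then have f0: "f x = 0" if "x \<in> S" for x using that by auto
    have "poly W x = 0" if x: "x \<in> S" for x
    proof -
      have "(f has_field_derivative 0) (at x)"
        using has_field_derivative_transform_within_open[of "\<lambda>x. 0" 0 x S f] f0 S(1) x by auto
      then have "t x / x = 0" using df[OF x] DERIV_unique by blast
      then have "t x = 0" using x ln_branch(1) by (auto simp: S_def z_def)
      then show ?thesis using Weq[of x] f0[OF x] \<open>\<alpha> \<noteq> 0\<close> by simp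
    qed
    then have "S \<subseteq> {x. poly W x = 0}" by auto
    moreover have "infinite S" using S(1,3) finite_imp_not_open[of S] by auto
    ultimately show False using W0 poly_roots_finite[of W] finite_subset by (auto simp: W_def)
  qed
  from zorder_exist_zero[OF hf S this] obtain r where r: "r > 0" "cball z r \<subseteq> S"
    "zor_poly f z holomorphic_on cball z r"
    "\<And>x. x \<in> cball z r \<Longrightarrow> f x = zor_poly f z x * (x - z) ^ nat (zorder f z)"
    by blast
  define g where "g = zor_poly f z"
  have fg: "f x = g x * (x - z) ^ Suc m" if "x \<in> ball z r" for x
    using r(4)[of x] that zf by (simp add: g_def nat_add_distrib)
  have hg: "g holomorphic_on ball z r" using r(3) unfolding g_def by (rule holomorphic_on_subset) auto
  define H where "H = (\<lambda>x. ((x - z) * g x * c2 x - x * (deriv g x * (x - z) + of_nat (Suc m) * g x) * b2 x)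
     / (\<alpha> * exp ((l1 + l2) * ln_branch w x)))"
  have eqH: "poly W x = (x - z) ^ m * H x" if x: "x \<in> ball z r" for x
  proof -
    have xS: "x \<in> S" using x r(2) by auto
    have "(g has_field_derivative deriv g x) (at x)" using hg x holomorphic_derivI by blast
    then have "((\<lambda>x. g x * (x - z) ^ Suc m) has_field_derivative
        deriv g x * (x - z) ^ Suc m + g x * (of_nat (Suc m) * (x - z) ^ m)) (at x)"
      by (auto intro!: derivative_eq_intros simp del: power_Suc)
    then have "(f has_field_derivative
        deriv g x * (x - z) ^ Suc m + g x * (of_nat (Suc m) * (x - z) ^ m)) (at x)"
      by (rule has_field_derivative_transform_within_open[where S = "ball z r"]) (use x fg in auto)
    then have "t x / x = deriv g x * (x - z) ^ Suc m + g x * (of_nat (Suc m) * (x - z) ^ m)"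
      using df[OF xS] DERIV_unique by blast
    moreover have "x \<noteq> 0" using xS ln_branch(1) by (auto simp: S_def z_def)
    ultimately have tx: "t x = x * (deriv g x * (x - z) ^ Suc m + g x * (of_nat (Suc m) * (x - z) ^ m))"
      by (simp add: field_simps del: of_nat_Suc power_Suc)
    then have "\<alpha> * (exp ((l1 + l2) * ln_branch w x) * poly W x) =
      (x - z) ^ m * ((x - z) * g x * c2 x - x * (deriv g x * (x - z) + of_nat (Suc m) * g x) * b2 x)"
      unfolding Weq[symmetric] fg[OF x] tx by (simp add: algebra_simps)
    then show ?thesis using \<open>\<alpha> \<noteq> 0\<close> unfolding H_def by (simp add: divide_simps mult_ac del: of_nat_Suc)
  qed
  have "\<forall>\<^sub>F x in at z. x \<in> ball z r" using r(1) eventually_at_in_open'[of "ball z r" z] by simp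
  then have ev: "\<forall>\<^sub>F x in at z. poly W x = (x - z) ^ m * H x" by eventually_elim (rule eqH)
  have "isCont g z" "isCont (deriv g) z"
    using hg holomorphic_deriv[OF hg] r(1) continuous_on_interior holomorphic_on_imp_continuous_on
    by (metis centre_in_ball interior_open open_ball)+
  moreover have "isCont (branch l p w) z" for l p
    using branch_has_derivative[of z w l p] S(3) by (intro DERIV_isCont) (auto simp: S_def z_def)
  moreover have "isCont (ln_branch w) z"
    using ln_branch(3)[of z w] S(3) by (intro DERIV_isCont) (auto simp: S_def z_def)
  ultimately have "isCont H z"
    unfolding H_def b2_def c2_def by (intro continuous_intros) (use \<open>\<alpha> \<noteq> 0\<close> in auto)
  then show ?thesis using linear_power_dvd[OF _ ev] W0 by (simp add: W_def z_def)
qed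

text \<open>
  The two powers are coprime factors, and they already exhaust the degree.
\<close>
lemma wronskian_poly_factorization:
  fixes z1 z2 :: complex
  assumes z: "z1 \<noteq> z2" and n: "degree p1 + degree p2 = m1 + m2"
    and 1: "[:-z1, 1:] ^ m1 dvd wronskian_poly dl p1 p2" and 2: "[:-z2, 1:] ^ m2 dvd wronskian_poly dl p1 p2"
    and W0: "wronskian_poly dl p1 p2 \<noteq> 0"
  obtains K where "K \<noteq> 0" "wronskian_poly dl p1 p2 = smult K ([:-z1, 1:] ^ m1 * [:-z2, 1:] ^ m2)"
proof -
  define W where "W = wronskian_poly dl p1 p2"
  have "coprime [:-z1, 1:] [:-z2, 1:]"
  proof (rule coprimeI)
    fix c assume "c dvd [:-z1, 1:]" "c dvd [:-z2, 1:]"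
    then have "c dvd [:-z1, 1:] - [:-z2, 1:]" by (rule dvd_diff)
    moreover have "[:-z1, 1:] - [:-z2, 1:] = [:z2 - z1:]" by simp
    moreover have "[:z2 - z1:] dvd 1" using z by (simp add: is_unit_const_poly_iff dvd_field_iff)
    ultimately show "is_unit c" using dvd_trans by metis
  qed
  then have "[:-z1, 1:] ^ m1 * [:-z2, 1:] ^ m2 dvd W"
    using 1 2 unfolding W_def by (intro divides_mult) auto
  then obtain R where R: "W = [:-z1, 1:] ^ m1 * [:-z2, 1:] ^ m2 * R" by blast
  have R0: "R \<noteq> 0" using R W0 by (auto simp: W_def)
  have "degree W \<le> m1 + m2"
  proof -
    have a: "degree (p1 * p2) \<le> m1 + m2" using degree_mult_le[of p1 p2] n by simp
    have "degree ([:0, 1:] * pderiv p * q) \<le> degree p + degree q" for p q :: "complex poly"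
    proof (cases "degree p = 0")
      case True
      then show ?thesis by (simp add: pderiv_eq_0_iff[THEN iffD2])
    next
      case False
      have "degree ([:0, 1:] * pderiv p * q) \<le> (1 + degree (pderiv p)) + degree q"
        using degree_mult_le[of "[:0, 1:] * pderiv p" q] degree_mult_le[of "[:0, 1:]" "pderiv p"] by simp
      then show ?thesis using False by (simp add: degree_pderiv)
    qed
    from this[of p2 p1] this[of p1 p2] a n
    have "degree ([:0, 1:] * pderiv p2 * p1) \<le> m1 + m2" "degree ([:0, 1:] * pderiv p1 * p2) \<le> m1 + m2"
      by auto
    then have "degree (smult dl (p1 * p2) + ([:0, 1:] * pderiv p2 * p1 - [:0, 1:] * pderiv p1 * p2)) \<le> m1 + m2"
      using a by (intro degree_add_le degree_diff_le) (auto intro: order_trans[OF degree_smult_le])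
    then show ?thesis by (simp add: W_def wronskian_poly_def algebra_simps)
  qed
  moreover have "degree W = m1 + m2 + degree R"
    unfolding R using R0 by (simp add: degree_mult_eq degree_power_eq)
  ultimately have "degree R = 0" by simp
  then obtain K where "R = [:K:]" using degree_eq_zeroE by blast
  then show ?thesis using that[of K] R R0 by (simp add: W_def)
qed

section \<open>The difference equation of the bispectral dual\<close>

text \<open>
  The middle coefficient of the difference equation of the bispectral dual. The parameter \<open>h\<close> is the accessory
  parameter of the differential equation of the space, normalized symmetrically in its two basis functions.
\<close>
definition dual_coeff ::
  "nat \<Rightarrow> nat \<Rightarrow> complex \<Rightarrow> complex \<Rightarrow> complex \<Rightarrow> complex \<Rightarrow> complex \<Rightarrow> complex \<Rightarrow> complex" where
  "dual_coeff m1 m2 z1 z2 l1 l2 h u =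
     u * (of_nat m1 * z2 + of_nat m2 * z1) - h - (z1 + z2) * (u - l1) * (u - l2)"

text \<open>
  Heun's equation for \<open>p\<close>, rewritten for \<open>x powr l * p\<close> with Euler derivatives. In this form it is symmetric
  under exchanging \<open>(l, n)\<close> with \<open>(l', n')\<close>, so both basis functions solve the same equation.
\<close>
lemma heun_branch:
  fixes x :: complex
  assumes heun: "heun m1 m2 z1 z2 n (l - l') (h - l * (of_nat m1 * z2 + of_nat m2 * z1)) p = 0"
    and n: "n + n' = m1 + m2"
  shows "(x - z1) * (x - z2) * branch l (euler l (euler l p)) w x
     - ((x - z1) * (x - z2) * (l + l') + x * (of_nat m1 * (x - z2) + of_nat m2 * (x - z1))) * branch l (euler l p) w x
     + ((x - z1) * (x - z2) * l * l' - h * x + ((l + of_nat n) * (l' + of_nat n') - l * l') * x^2)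
        * branch l p w x = 0"
proof -
  define P where "P = poly p x"
  define P' where "P' = poly (pderiv p) x"
  define P'' where "P'' = poly (pderiv (pderiv p)) x"
  define E where "E = exp (l * ln_branch w x)"
  have b: "branch l p w x = E * P" "branch l (euler l p) w x = E * (l * P + x * P')"
    "branch l (euler l (euler l p)) w x = E * (l^2 * P + (2 * l + 1) * x * P' + x^2 * P'')"
    by (simp_all add: branch_def euler_def E_def P_def P'_def P''_def pderiv_add pderiv_smult pderiv_mult
        pderiv_pCons power2_eq_square algebra_simps)
  have "of_nat n + of_nat n' = of_nat m1 + (of_nat m2 :: complex)" using n by (metis of_nat_add)
  then have n': "of_nat n' = of_nat m1 + of_nat m2 - (of_nat n :: complex)" by (simp add: algebra_simps)
  define H0 where "H0 = (x - z1) * (x - z2) * (x * P'' + (1 + (l - l')) * P')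
     - x * (of_nat m1 * (x - z2) + of_nat m2 * (x - z1)) * P'
     - (h - l * (of_nat m1 * z2 + of_nat m2 * z1) - x * of_nat n * (of_nat m1 + of_nat m2 - of_nat n - (l - l'))) * P"
  have "H0 = poly (heun m1 m2 z1 z2 n (l - l') (h - l * (of_nat m1 * z2 + of_nat m2 * z1)) p) x"
    by (simp only: H0_def poly_heun P_def P'_def P''_def)
  then have 0: "H0 = 0" by (simp add: heun)
  have "(x - z1) * (x - z2) * (E * (l^2 * P + (2 * l + 1) * x * P' + x^2 * P''))
     - ((x - z1) * (x - z2) * (l + l') + x * (of_nat m1 * (x - z2) + of_nat m2 * (x - z1))) * (E * (l * P + x * P'))
     + ((x - z1) * (x - z2) * l * l' - h * x + ((l + of_nat n) * (l' + of_nat n') - l * l') * x^2)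
        * (E * P) = E * x * H0"
    unfolding H0_def n' by (simp add: power2_eq_square algebra_simps)
  then show ?thesis unfolding b 0 by simp
qed

lemma inverse_power_has_derivative:
  assumes "x \<noteq> (a :: complex)"
  shows "((\<lambda>x. inverse ((x - a) ^ m)) has_field_derivative
           - (of_nat m / (x - a)) * inverse ((x - a) ^ m)) (at x)"
proof -
  have "((\<lambda>x. inverse ((x - a) ^ m)) has_field_derivative
          - (inverse ((x - a) ^ m) * (of_nat m * (x - a) ^ (m - 1)) * inverse ((x - a) ^ m))) (at x)"
    using assms by (auto intro!: derivative_eq_intros)
  moreover have "inverse ((x - a) ^ m) * (of_nat m * (x - a) ^ (m - 1)) * inverse ((x - a) ^ m) =
      (of_nat m / (x - a)) * inverse ((x - a) ^ m)"
    using assms by (cases m) (simp_all add: divide_simps)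
  ultimately show ?thesis by (metis mult_minus_left)
qed

text \<open>
  The bracket on the right is the polynomial by which the operator acts on the kernel \<open>x powr u\<close>. The primitive
  is the boundary term of two integrations by parts. It has the form \<open>x powr (u - 1) * M * (x * y' - u * y)\<close> with \<open>M\<close>
  inverse to the Wronskian; in its derivative the equation removes \<open>y''\<close>, and then the terms with \<open>y'\<close> cancel.
\<close>
lemma bispectral_primitive:
  fixes z1 z2 s u x B :: complex and y t t' L :: "complex \<Rightarrow> complex"
  assumes x: "x \<noteq> 0" "x \<noteq> z1" "x \<noteq> z2"
    and L: "(L has_field_derivative 1 / x) (at x)"
    and y: "(y has_field_derivative t x / x) (at x)" and t: "(t has_field_derivative t' x / x) (at x)"
    and ode: "(x - z1) * (x - z2) * t' x
     - ((x - z1) * (x - z2) * s + x * (of_nat m1 * (x - z2) + of_nat m2 * (x - z1))) * t x + B * y x = 0"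
  shows "((\<lambda>x. exp ((u - s) * L x) * inverse ((x - z1) ^ m1) * inverse ((x - z2) ^ m2) * (t x - u * y x))
     has_field_derivative
       - (exp ((u - s) * L x) * inverse ((x - z1) ^ m1) * inverse ((x - z2) ^ m2)
          * inverse (x - z1) * inverse (x - z2) * inverse x
          * (B + (x - z1) * (x - z2) * u * (u - s) - u * x * (of_nat m1 * (x - z2) + of_nat m2 * (x - z1)))
          * y x)) (at x)"
proof -
  define E where "E = exp ((u - s) * L x)"
  define M1 where "M1 = inverse ((x - z1) ^ m1)"
  define M2 where "M2 = inverse ((x - z2) ^ m2)"
  define X where "X = x - z1"
  define Y where "Y = x - z2"
  have XY: "X \<noteq> 0" "Y \<noteq> 0" using x by (auto simp: X_def Y_def)
  have E: "((\<lambda>x. exp ((u - s) * L x)) has_field_derivative E * ((u - s) * (1 / x))) (at x)"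
    unfolding E_def by (auto intro!: derivative_eq_intros L)
  have F: "((\<lambda>x. t x - u * y x) has_field_derivative t' x / x - u * (t x / x)) (at x)"
    by (auto intro!: derivative_eq_intros y t)
  note M = inverse_power_has_derivative[OF x(2), of m1] inverse_power_has_derivative[OF x(3), of m2]
  have d: "((\<lambda>x. exp ((u - s) * L x) * inverse ((x - z1) ^ m1) * inverse ((x - z2) ^ m2) * (t x - u * y x))
     has_field_derivative
       ((E * ((u - s) * (1 / x)) * M1 + (- (of_nat m1 / X) * M1) * E) * M2 + (- (of_nat m2 / Y) * M2) * (E * M1))
         * (t x - u * y x) + (t' x / x - u * (t x / x)) * (E * M1 * M2)) (at x)"
    using DERIV_mult[OF DERIV_mult[OF DERIV_mult[OF E M(1)] M(2)] F]
    by (simp add: E_def M1_def M2_def X_def Y_def)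
  define K where "K = E * M1 * M2 * inverse X * inverse Y * inverse x"
  define Z where "Z = X * Y * (u - s) * (t x - u * y x)
       - x * of_nat m1 * Y * (t x - u * y x) - x * of_nat m2 * X * (t x - u * y x) + X * Y * (t' x - u * t x)"
  have "(t' x / x - u * (t x / x)) = (t' x - u * t x) / x" by (simp add: diff_divide_distrib)
  then have "((E * ((u - s) * (1 / x)) * M1 + (- (of_nat m1 / X) * M1) * E) * M2 + (- (of_nat m2 / Y) * M2) * (E * M1))
         * (t x - u * y x) + (t' x / x - u * (t x / x)) * (E * M1 * M2) = K * Z"
    unfolding K_def Z_def using XY x(1) by (simp add: field_simps)
  also have "Z = - ((B + X * Y * u * (u - s) - u * x * (of_nat m1 * Y + of_nat m2 * X)) * y x)
     + (X * Y * t' x - (X * Y * s + x * (of_nat m1 * Y + of_nat m2 * X)) * t x + B * y x)"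
    unfolding Z_def by (simp add: algebra_simps)
  also have "\<dots> = - ((B + X * Y * u * (u - s) - u * x * (of_nat m1 * Y + of_nat m2 * X)) * y x)"
    using ode by (simp add: X_def Y_def)
  finally show ?thesis using d
    by (simp add: K_def E_def M1_def M2_def X_def Y_def mult.assoc)
qed

text \<open>
  Bispectrality: sorted by powers of \<open>x\<close>, which act as shifts of \<open>u\<close>, the same polynomial has the coefficients of
  the difference equation.
\<close>
lemma bispectral_kernel:
  assumes n: "n1 + n2 = m1 + m2"
  shows "(x - z1) * (x - z2) * l1 * l2 - h * x + ((l1 + of_nat n1) * (l2 + of_nat n2) - l1 * l2) * x^2
      + (x - z1) * (x - z2) * u * (u - (l1 + l2)) - u * x * (of_nat m1 * (x - z2) + of_nat m2 * (x - z1)) =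
    z1 * z2 * (u - l1) * (u - l2) + dual_coeff m1 m2 z1 z2 l1 l2 h u * x
      + (u - l1 - of_nat n1) * (u - l2 - of_nat n2) * x^2"
proof -
  have "of_nat n1 + of_nat n2 = of_nat m1 + (of_nat m2 :: complex)" using n by (metis of_nat_add)
  then have n2: "of_nat n2 = of_nat m1 + of_nat m2 - (of_nat n1 :: complex)" by (simp add: algebra_simps)
  show ?thesis unfolding dual_coeff_def n2 by (simp add: power2_eq_square algebra_simps)
qed

lemma wronskian_quasi_polynomials:
  assumes "g \<in> quasi_polynomials l1 p1 l2 p2 w" "k \<in> quasi_polynomials l1 p1 l2 p2 w"
  obtains D where "\<And>x. x \<in> ball (exp w) (norm (exp w)) \<Longrightarrow>
     wronskian g k x = D * exp ((l1 + l2) * ln_branch w x) / x * poly (wronskian_poly (l2 - l1) p1 p2) x"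
proof -
  obtain a b where g: "g = (\<lambda>x. a * branch l1 p1 w x + b * branch l2 p2 w x)"
    using assms(1) unfolding in_quasi_polynomials by blast
  obtain c d where k: "k = (\<lambda>x. c * branch l1 p1 w x + d * branch l2 p2 w x)"
    using assms(2) unfolding in_quasi_polynomials by blast
  have "wronskian g k x = (a * d - b * c) * exp ((l1 + l2) * ln_branch w x) / x * poly (wronskian_poly (l2 - l1) p1 p2) x"
    if x: "x \<in> ball (exp w) (norm (exp w))" for x
  proof -
    have d: "((\<lambda>x. \<alpha> * branch l1 p1 w x + \<beta> * branch l2 p2 w x) has_field_derivative
        \<alpha> * (branch l1 (euler l1 p1) w x / x) + \<beta> * (branch l2 (euler l2 p2) w x / x)) (at x)" for \<alpha> \<beta>
      using DERIV_add[OF DERIV_cmult DERIV_cmult] branch_has_derivative[OF x] by blast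
    have "wronskian g k x = (a * d - b * c) / x *
       (branch l1 p1 w x * branch l2 (euler l2 p2) w x - branch l1 (euler l1 p1) w x * branch l2 p2 w x)"
      unfolding wronskian_def g k d[THEN DERIV_imp_deriv] using ln_branch(1)[OF x]
      by (simp add: field_simps)
    then show ?thesis unfolding branch_wronskian by simp
  qed
  then show ?thesis using that by blast
qed

text \<open>
  The integrands \<open>J u\<close>, \<open>J (u + 1) = x * J u\<close> and \<open>J (u + 2)\<close>, combined with the coefficients of the equation, have,
  up to a constant factor, the primitive of \<open>bispectral_primitive\<close>, which is single-valued near the circle; so the
  integral is zero.
\<close>
lemma bispectral_integrals_difference_equation:
  fixes z1 z2 l1 l2 w u :: complex
  assumes n: "n1 + n2 = m1 + m2" and z: "z1 \<noteq> z2" "exp w = z1 \<or> exp w = z2"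
    and heun1: "heun m1 m2 z1 z2 n1 (l1 - l2) (h - l1 * (of_nat m1 * z2 + of_nat m2 * z1)) p1 = 0"
    and heun2: "heun m1 m2 z1 z2 n2 (l2 - l1) (h - l2 * (of_nat m1 * z2 + of_nat m2 * z1)) p2 = 0"
    and W: "wronskian_poly (l2 - l1) p1 p2 = smult K ([:-z1, 1:] ^ m1 * [:-z2, 1:] ^ m2)"
    and G: "G \<in> bispectral_integrals z1 z2 (quasi_polynomials l1 p1 l2 p2) w"
  shows "z1 * z2 * (u - l1) * (u - l2) * G u + dual_coeff m1 m2 z1 z2 l1 l2 h u * G (u + 1)
      + (u - l1 - of_nat n1) * (u - l2 - of_nat n2) * G (u + 2) = 0"
proof -
  define L where "L = ln_branch w"
  obtain f where f: "f \<in> star_space (quasi_polynomials l1 p1 l2 p2 w)" and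
    G: "\<forall>\<^sub>F r in at_right 0. \<forall>u. G u = contour_integral (circlepath (exp w) r)
       (\<lambda>x. exp (u * L x) * f x * x powi (-2) * inverse (x - z1) * inverse (x - z2))"
    using G unfolding bispectral_integrals_def L_def by blast
  obtain y g k where fy: "f = (\<lambda>x. y x / wronskian g k x)"
    and y: "y \<in> quasi_polynomials l1 p1 l2 p2 w"
    and b: "is_basis2 (quasi_polynomials l1 p1 l2 p2 w) g k"
    using f unfolding star_space_def by blast
  have "cfun.span {g, k} = quasi_polynomials l1 p1 l2 p2 w" using b unfolding is_basis2_def by (elim conjE)
  then have "{g, k} \<subseteq> quasi_polynomials l1 p1 l2 p2 w" using cfun.span_superset[of "{g, k}"] by (simp only:)
  then obtain D where D: "\<And>x. x \<in> ball (exp w) (norm (exp w)) \<Longrightarrow>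
     wronskian g k x = D * exp ((l1 + l2) * L x) / x * poly (wronskian_poly (l2 - l1) p1 p2) x"
    using wronskian_quasi_polynomials[of g l1 p1 l2 p2 w k] unfolding L_def by auto
  obtain a b where y: "y = (\<lambda>x. a * branch l1 p1 w x + b * branch l2 p2 w x)"
    using y unfolding in_quasi_polynomials by blast
  define t where "t = (\<lambda>x. a * branch l1 (euler l1 p1) w x + b * branch l2 (euler l2 p2) w x)"
  define t' where "t' = (\<lambda>x. a * branch l1 (euler l1 (euler l1 p1)) w x + b * branch l2 (euler l2 (euler l2 p2)) w x)"
  define R where "R = min (norm (exp w)) (norm (z1 - z2))"
  define S where "S = ball (exp w) R - {exp w}"
  have "R > 0" using z by (simp add: R_def)
  have S: "x \<in> ball (exp w) (norm (exp w))" "x \<noteq> z1" "x \<noteq> z2" "x \<noteq> 0" "exp (L x) = x"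
    "(L has_field_derivative 1 / x) (at x)" if "x \<in> S" for x
  proof -
    show x: "x \<in> ball (exp w) (norm (exp w))" using that by (auto simp: S_def R_def)
    show "x \<noteq> z1" "x \<noteq> z2" using that z(2) by (auto simp: S_def R_def dist_norm norm_minus_commute)
    show "x \<noteq> 0" "exp (L x) = x" "(L has_field_derivative 1 / x) (at x)"
      using ln_branch[OF x] by (auto simp: L_def)
  qed
  have dy: "(y has_field_derivative t x / x) (at x)" and dt: "(t has_field_derivative t' x / x) (at x)"
    if "x \<in> S" for x
  proof -
    have d: "((\<lambda>x. a * branch l1 p w x + b * branch l2 q w x) has_field_derivative
        (a * branch l1 (euler l1 p) w x + b * branch l2 (euler l2 q) w x) / x) (at x)" for p q
      using DERIV_add[OF DERIV_cmult[OF branch_has_derivative] DERIV_cmult[OF branch_has_derivative], OF S(1) S(1), OF that that]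
      by (simp add: add_divide_distrib)
    show "(y has_field_derivative t x / x) (at x)" "(t has_field_derivative t' x / x) (at x)"
      unfolding y t_def t'_def by (rule d)+
  qed
  define B where "B = (\<lambda>x. (x - z1) * (x - z2) * l1 * l2 - h * x + ((l1 + of_nat n1) * (l2 + of_nat n2) - l1 * l2) * x^2)"
  have ode: "(x - z1) * (x - z2) * t' x
     - ((x - z1) * (x - z2) * (l1 + l2) + x * (of_nat m1 * (x - z2) + of_nat m2 * (x - z1))) * t x + B x * y x = 0" for x
  proof -
    have B': "B x = (x - z1) * (x - z2) * l2 * l1 - h * x + ((l2 + of_nat n2) * (l1 + of_nat n1) - l2 * l1) * x^2"
      by (simp add: B_def mult_ac)
    define X where "X = (x - z1) * (x - z2)"
    define M where "M = X * (l1 + l2) + x * (of_nat m1 * (x - z2) + of_nat m2 * (x - z1))"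
    have 1: "X * branch l1 (euler l1 (euler l1 p1)) w x - M * branch l1 (euler l1 p1) w x + B x * branch l1 p1 w x = 0"
      unfolding X_def M_def B_def by (rule heun_branch[OF heun1 n])
    have 2: "X * branch l2 (euler l2 (euler l2 p2)) w x - M * branch l2 (euler l2 p2) w x + B x * branch l2 p2 w x = 0"
      using heun_branch[OF heun2, of n1 x w] n unfolding X_def M_def B' by (simp only: add.commute)
    have "X * t' x - M * t x + B x * y x =
       a * (X * branch l1 (euler l1 (euler l1 p1)) w x - M * branch l1 (euler l1 p1) w x + B x * branch l1 p1 w x)
     + b * (X * branch l2 (euler l2 (euler l2 p2)) w x - M * branch l2 (euler l2 p2) w x + B x * branch l2 p2 w x)"
      unfolding y t_def t'_def by (simp add: algebra_simps)
    then show ?thesis unfolding 1 2 by (simp add: X_def M_def)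
  qed
  \<comment> \<open>If \<open>D = 0\<close>, then division by zero makes the integrand zero, in agreement with \<open>c = 0\<close>.\<close>
  define c where "c = inverse (D * K)"
  define J where "J = (\<lambda>u x. c * (exp ((u - (l1 + l2)) * L x) * inverse ((x - z1) ^ m1) * inverse ((x - z2) ^ m2)
          * inverse (x - z1) * inverse (x - z2) * inverse x) * y x)"
  have J: "exp (u * L x) * f x * x powi (-2) * inverse (x - z1) * inverse (x - z2) = J u x" if x: "x \<in> S" for u x
  proof -
    have "exp ((u - (l1 + l2)) * L x) = exp (u * L x) * inverse (exp ((l1 + l2) * L x))"
      by (simp add: left_diff_distrib exp_diff divide_inverse)
    moreover have "x powi (-2) = inverse x * inverse x"
      by (simp add: power_int_minus power2_eq_square)
    ultimately show ?thesis
      unfolding J_def fy D[OF S(1)[OF x]] W c_def using S(4)[OF x]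
      by (simp add: divide_inverse mult_ac)
  qed
  have J_shift: "J (u + 1) x = x * J u x" if "x \<in> S" for u x
  proof -
    have "(u + 1 - (l1 + l2)) * L x = (u - (l1 + l2)) * L x + L x" by (simp add: algebra_simps)
    then have "exp ((u + 1 - (l1 + l2)) * L x) = exp ((u - (l1 + l2)) * L x) * x"
      using S(5)[OF that] by (simp only: exp_add)
    then show ?thesis by (simp add: J_def)
  qed
  define F where "F = (\<lambda>x. exp ((u - (l1 + l2)) * L x) * inverse ((x - z1) ^ m1) * inverse ((x - z2) ^ m2) * (t x - u * y x))"
  define F' where "F' = (\<lambda>x. z1 * z2 * (u - l1) * (u - l2) * J u x + dual_coeff m1 m2 z1 z2 l1 l2 h u * J (u + 1) x
      + (u - l1 - of_nat n1) * (u - l2 - of_nat n2) * J (u + 2) x)"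
  have F: "((\<lambda>x. - c * F x) has_field_derivative F' x) (at x within S)" if x: "x \<in> S" for x
  proof -
    have "((\<lambda>x. - c * F x) has_field_derivative
        - c * - (exp ((u - (l1 + l2)) * L x) * inverse ((x - z1) ^ m1) * inverse ((x - z2) ^ m2)
          * inverse (x - z1) * inverse (x - z2) * inverse x
          * (B x + (x - z1) * (x - z2) * u * (u - (l1 + l2)) - u * x * (of_nat m1 * (x - z2) + of_nat m2 * (x - z1)))
          * y x)) (at x)"
      unfolding F_def
      by (intro DERIV_cmult bispectral_primitive[OF S(4,2,3,6) dy dt ode] x)
    also have "- c * - (exp ((u - (l1 + l2)) * L x) * inverse ((x - z1) ^ m1) * inverse ((x - z2) ^ m2)
          * inverse (x - z1) * inverse (x - z2) * inverse x
          * (B x + (x - z1) * (x - z2) * u * (u - (l1 + l2)) - u * x * (of_nat m1 * (x - z2) + of_nat m2 * (x - z1)))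
          * y x) =
       (B x + (x - z1) * (x - z2) * u * (u - (l1 + l2)) - u * x * (of_nat m1 * (x - z2) + of_nat m2 * (x - z1))) * J u x"
      unfolding J_def by (simp only: mult_minus_left mult_minus_right minus_minus mult_ac)
    also have "\<dots> = F' x"
      using J_shift[OF x, of u] J_shift[OF x, of "u + 1"]
      unfolding B_def bispectral_kernel[OF n] F'_def by (simp add: algebra_simps power2_eq_square)
    finally show ?thesis by (rule has_field_derivative_at_within)
  qed
  have "\<forall>\<^sub>F r in at_right (0::real). r \<in> {0<..<R}"
    using eventually_at_right_real[OF \<open>R > 0\<close>] .
  with G have "\<forall>\<^sub>F r in at_right (0::real). r \<in> {0<..<R} \<and> (\<forall>u. G u = contour_integral (circlepath (exp w) r)
       (\<lambda>x. exp (u * L x) * f x * x powi (-2) * inverse (x - z1) * inverse (x - z2)))"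
    by eventually_elim auto
  from eventually_happens'[OF _ this] obtain r where r: "0 < r" "r < R"
    and Gr: "\<And>u. G u = contour_integral (circlepath (exp w) r)
       (\<lambda>x. exp (u * L x) * f x * x powi (-2) * inverse (x - z1) * inverse (x - z2))"
    by auto
  have im: "path_image (circlepath (exp w) r) \<subseteq> S" using r by (auto simp: S_def dist_norm)
  have GJ: "(J u has_contour_integral G u) (circlepath (exp w) r)" for u
  proof -
    have "isCont (J u) x" if x: "x \<in> S" for x
      unfolding J_def using S(2,3,4)[OF x] DERIV_isCont[OF S(6)[OF x]] DERIV_isCont[OF dy[OF x]]
      by (intro continuous_intros) auto
    then have "continuous_on (path_image (circlepath (exp w) r)) (J u)"
      using im by (auto intro!: continuous_at_imp_continuous_on)
    then have "J u contour_integrable_on circlepath (exp w) r"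
      by (rule contour_integrable_continuous_circlepath)
    moreover have "G u = contour_integral (circlepath (exp w) r) (J u)"
      unfolding Gr by (rule contour_integral_eq) (use im J in auto)
    ultimately show ?thesis by (simp add: has_contour_integral_integral)
  qed
  have "(F' has_contour_integral (z1 * z2 * (u - l1) * (u - l2) * G u + dual_coeff m1 m2 z1 z2 l1 l2 h u * G (u + 1)
      + (u - l1 - of_nat n1) * (u - l2 - of_nat n2) * G (u + 2))) (circlepath (exp w) r)"
    unfolding F'_def by (intro has_contour_integral_add has_contour_integral_lmul GJ)
  moreover have "(F' has_contour_integral 0) (circlepath (exp w) r)"
    by (rule Cauchy_theorem_primitive[OF F]) (use im in auto)
  ultimately show ?thesis by (rule has_contour_integral_unique)
qed

lemma special_bispectral_dual_difference_equation:
  fixes l1 l2 w1 w2 u :: complex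
  assumes n: "n1 + n2 = m1 + m2" and z: "exp w1 = z1" "exp w2 = z2" "z1 \<noteq> z2"
    and heun: "heun m1 m2 z1 z2 n1 (l1 - l2) (h - l1 * (of_nat m1 * z2 + of_nat m2 * z1)) p1 = 0"
      "heun m1 m2 z1 z2 n2 (l2 - l1) (h - l2 * (of_nat m1 * z2 + of_nat m2 * z1)) p2 = 0"
    and W: "wronskian_poly (l2 - l1) p1 p2 = smult K ([:-z1, 1:] ^ m1 * [:-z2, 1:] ^ m2)"
    and G: "G \<in> special_bispectral_dual w1 w2 (quasi_polynomials l1 p1 l2 p2)"
  shows "z1 * z2 * (u - l1) * (u - l2) * G u + dual_coeff m1 m2 z1 z2 l1 l2 h u * G (u + 1)
      + (u - l1 - of_nat n1) * (u - l2 - of_nat n2) * G (u + 2) = 0"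
proof -
  define P where "P = (\<lambda>x. z1 * z2 * (u - l1) * (u - l2) * x u + dual_coeff m1 m2 z1 z2 l1 l2 h u * x (u + 1)
      + (u - l1 - of_nat n1) * (u - l2 - of_nat n2) * x (u + 2))"
  have lin: "P (cscale c x + y) = c * P x + P y" for c x y
    unfolding P_def cscale_def plus_fun_def by (simp only: algebra_simps)
  have "P G = 0"
    using G unfolding special_bispectral_dual_def
  proof (induction rule: cfun.span_induct_alt)
    case base
    then show ?case by (simp add: P_def)
  next
    case (step c x y)
    have "P x = 0"
      using step(1) z bispectral_integrals_difference_equation[OF n z(3) _ heun W] by (auto simp: P_def)
    then show ?case using step(2) by (simp only: lin mult_zero_right add_0_left)
  qed
  then show ?thesis by (simp add: P_def)
qed

section \<open>Comparison of the coefficients\<close>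

lemma tridiag_coefficients:
  assumes "heun m1 m2 z1 z2 n dl h (binary_form z1 z2 n s) = 0" "z1 \<noteq> z2" "k \<in> {0..int n}"
  shows "tridiag m1 m2 z1 z2 n dl h s k = 0"
  using binary_form_eq_0[of z1 z2 n "tridiag m1 m2 z1 z2 n dl h s" "nat k"] assms
  by (simp add: heun_binary_form nat_le_iff)

lemma binary_form_eqI:
  assumes "\<And>x. poly p x = (\<Sum>i=0..n. c i * ((x - z1) ^ (n - i) / fact (n - i)) * ((x - z2) ^ i / fact i))"
  shows "p = binary_form z1 z2 n (\<lambda>k. c (nat k))"
proof -
  have "poly p x = poly (binary_form z1 z2 n (\<lambda>k. c (nat k))) x" for x
    unfolding assms binary_form_def poly_sum atLeast0AtMost
    by (rule sum.cong) (simp_all add: binary_monomial_def)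
  then show ?thesis by (simp add: poly_eq_poly_eq_iff[symmetric] fun_eq_iff)
qed

theorem theorem10p5:
  fixes n1 n2 m1 m2 :: nat
    and l1 l2 z1 z2 w1 w2 :: complex
    and p1 p2 q1 q2 :: "complex poly"
    and c d e f :: "nat \<Rightarrow> complex"
  assumes "n1 + n2 = m1 + m2"
    and "exp w1 = z1" and "exp w2 = z2"
    and "quasi_polynomial_type n1 n2 l1 l2 m1 m2 z1 z2 p1 p2"
    and "quasi_exponentials w1 q1 w2 q2 = special_bispectral_dual w1 w2 (quasi_polynomials l1 p1 l2 p2)"
    and "quasi_exponential_type m1 m2 w1 w2 n1 n2 (l1 + 1) (l2 + 1) q1 q2"
    and "nondegenerate p1 p2 z1 z2"
    and "\<And>x. poly p2 x =
           (\<Sum>i=0..n2. c i * ((x - z1) ^ (n2 - i) / fact (n2 - i)) * ((x - z2) ^ i / fact i))"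
    and "\<And>x. poly p1 x =
           (\<Sum>i=0..n1. d i * ((x - z1) ^ (n1 - i) / fact (n1 - i)) * ((x - z2) ^ i / fact i))"
    and "\<And>u. poly q2 u =
           (\<Sum>i=0..m2. e i / (fact (m2 - i) * fact i)
              * (\<Prod>j<m2 - i. u - l1 - 1 - of_nat n1 + of_nat j)
              * (\<Prod>j<i. u - l2 - 1 - of_nat j))"
    and "\<And>u. poly q1 u =
           (\<Sum>i=0..m1. f i / (fact (m1 - i) * fact i)
              * (\<Prod>j<m1 - i. u - l1 - 1 - of_nat n1 + of_nat j)
              * (\<Prod>j<i. u - l2 - 1 - of_nat j))"
  shows "\<exists>A B C :: complex. A \<noteq> 0 \<and> B \<noteq> 0 \<and> C \<noteq> 0 \<and>
           (\<forall>i\<in>{max 0 (n2 - m1)..min m2 n2}.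
              c i = A * d (m2 - i) * (z1 / z2) ^ i \<and> c i = B * e i \<and> c i = C * f (n2 - i))"
proof -
  note n = assms(1) and w = assms(2,3)
  have l: "l1 - l2 \<notin> \<int>" and z: "z1 \<noteq> 0" "z2 \<noteq> 0" "z1 \<noteq> z2"
    and deg: "degree p1 = n1" "degree p2 = n2" and p0: "poly p1 0 \<noteq> 0" "poly p2 0 \<noteq> 0"
    and ex1: "exponents (quasi_polynomials l1 p1 l2 p2 w1) z1 = {0, 1 + int m1}"
    and ex2: "exponents (quasi_polynomials l1 p1 l2 p2 w2) z2 = {0, 1 + int m2}"
    using assms(4) w unfolding quasi_polynomial_type_def by auto
  have pz: "poly p1 z1 \<noteq> 0" "poly p1 z2 \<noteq> 0" "poly p2 z1 \<noteq> 0" "poly p2 z2 \<noteq> 0"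
    using assms(7) by (auto simp: nondegenerate_def)
  have q: "q1 \<noteq> 0" "q2 \<noteq> 0" using assms(6) by (auto simp: quasi_exponential_type_def)
  define dl where "dl = l2 - l1"
  have dl: "dl \<notin> \<int>" "- dl \<notin> \<int>" using l Ints_minus[of dl] Ints_minus[of "- dl"] by (auto simp: dl_def)
  then have "dl \<noteq> 0" by auto
  have "poly (wronskian_poly dl p1 p2) 0 \<noteq> 0" using \<open>dl \<noteq> 0\<close> p0 by (simp add: wronskian_poly_def)
  then have W0: "wronskian_poly dl p1 p2 \<noteq> 0" by auto
  have "[:-z1, 1:] ^ m1 dvd wronskian_poly dl p1 p2" "[:-z2, 1:] ^ m2 dvd wronskian_poly dl p1 p2"
    using linear_power_dvd_wronskian_poly[of m1 l1 p1 l2 p2 w1] ex1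
      linear_power_dvd_wronskian_poly[of m2 l1 p1 l2 p2 w2] ex2 w pz W0
    by (simp_all add: dl_def)
  then obtain K where K: "K \<noteq> 0" "wronskian_poly dl p1 p2 = smult K ([:-z1, 1:] ^ m1 * [:-z2, 1:] ^ m2)"
    using wronskian_poly_factorization[OF z(3)] n deg W0 by metis
  define N where "N = of_nat m1 * z2 + of_nat m2 * z1"
  have "p2 \<noteq> 0" using p0 by auto
  obtain h1 where h1: "heun m1 m2 z1 z2 n1 (- dl) h1 p1 = 0" "heun m1 m2 z1 z2 n2 dl (h1 - dl * N) p2 = 0"
    using heun_equations[OF n deg(1) p0(1) pz(1,2) \<open>p2 \<noteq> 0\<close> K(2,1)] unfolding N_def by metis
  define h2 where "h2 = h1 - dl * N"
  define h where "h = h1 + l1 * N"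
  have diff: "z1 * z2 * (u - l1) * (u - l2) * G u + dual_coeff m1 m2 z1 z2 l1 l2 h u * G (u + 1)
      + (u - l1 - of_nat n1) * (u - l2 - of_nat n2) * G (u + 2) = 0"
    if "G \<in> quasi_exponentials w1 q1 w2 q2" for G u
  proof (rule special_bispectral_dual_difference_equation[OF n w z(3)])
    show "heun m1 m2 z1 z2 n1 (l1 - l2) (h - l1 * (of_nat m1 * z2 + of_nat m2 * z1)) p1 = 0"
      using h1(1) by (simp add: h_def N_def dl_def)
    have "h - l2 * (of_nat m1 * z2 + of_nat m2 * z1) = h1 - dl * N"
      by (simp add: h_def N_def dl_def algebra_simps)
    then show "heun m1 m2 z1 z2 n2 (l2 - l1) (h - l2 * (of_nat m1 * z2 + of_nat m2 * z1)) p2 = 0"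
      using h1(2) by (simp add: dl_def)
    show "wronskian_poly (l2 - l1) p1 p2 = smult K ([:-z1, 1:] ^ m1 * [:-z2, 1:] ^ m2)"
      using K by (simp add: dl_def)
    show "G \<in> special_bispectral_dual w1 w2 (quasi_polynomials l1 p1 l2 p2)"
      using that assms(5) by simp
  qed
  have diff_exp: "z1 * z2 * (u - l1) * (u - l2) * poly p u + dual_coeff m1 m2 z1 z2 l1 l2 h u * (exp v * poly p (u + 1))
      + (u - l1 - of_nat n1) * (u - l2 - of_nat n2) * (exp v * exp v * poly p (u + 2)) = 0"
    if "(\<lambda>u. exp (u * v) * poly p u) \<in> quasi_exponentials w1 q1 w2 q2" for u v p
  proof -
    have "exp ((u + 1) * v) = exp (u * v) * exp v" "exp ((u + 2) * v) = exp (u * v) * (exp v * exp v)"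
      by (simp_all add: exp_add[symmetric] algebra_simps)
    then have "exp (u * v) * (z1 * z2 * (u - l1) * (u - l2) * poly p u + dual_coeff m1 m2 z1 z2 l1 l2 h u * (exp v * poly p (u + 1))
      + (u - l1 - of_nat n1) * (u - l2 - of_nat n2) * (exp v * exp v * poly p (u + 2))) = 0"
      using diff[OF that, of u] by (simp add: algebra_simps)
    then show ?thesis by simp
  qed
  have "(\<lambda>u. exp (u * w1) * poly q1 u) \<in> quasi_exponentials w1 q1 w2 q2"
    "(\<lambda>u. exp (u * w2) * poly q2 u) \<in> quasi_exponentials w1 q1 w2 q2"
    unfolding quasi_exponentials_def by (auto intro: cfun.span_base)
  note de = this[THEN diff_exp, unfolded w]
  \<comment> \<open>The exponential factors cancel; for \<open>q1\<close> the points \<open>z1\<close> and \<open>z2\<close> appear exchanged.\<close>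
  have de2: "z1 * (u - l1) * (u - l2) * poly q2 u + dual_coeff m1 m2 z1 z2 l1 l2 h u * poly q2 (u + 1)
      + z2 * (u - l1 - of_nat n1) * (u - l2 - of_nat n2) * poly q2 (u + 2) = 0" (is "?a = 0") for u
  proof -
    have "z2 * ?a = 0" using de(2)[of u] by (simp add: algebra_simps)
    then show ?thesis using z by simp
  qed
  have de1: "z2 * (u - l1) * (u - l2) * poly q1 u + dual_coeff m1 m2 z1 z2 l1 l2 h u * poly q1 (u + 1)
      + z1 * (u - l1 - of_nat n1) * (u - l2 - of_nat n2) * poly q1 (u + 2) = 0" (is "?a = 0") for u
  proof -
    have "z1 * ?a = 0" using de(1)[of u] by (simp add: algebra_simps)
    then show ?thesis using z by simp
  qed
  define c' d' e' f' where "c' = (\<lambda>k. c (nat k))" and "d' = (\<lambda>k. d (nat k))"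
    and "e' = (\<lambda>k. e (nat k))" and "f' = (\<lambda>k. f (nat k))"
  have p2: "p2 = binary_form z1 z2 n2 c'" and p1: "p1 = binary_form z1 z2 n1 d'"
    unfolding c'_def d'_def by (rule binary_form_eqI, fact)+
  have q2: "poly q2 u = (\<Sum>k\<le>m2. e' (int k) * rising_falling m2 k (u - l1 - 1 - of_nat n1) (u - l2 - 1))" for u
    unfolding assms(10) rising_falling_def e'_def atLeast0AtMost by (simp add: mult.assoc)
  have q1: "poly q1 u = (\<Sum>k\<le>m1. f' (int k) * rising_falling m1 k (u - l1 - 1 - of_nat n1) (u - l2 - 1))" for u
    unfolding assms(11) rising_falling_def f'_def atLeast0AtMost by (simp add: mult.assoc)
  \<comment> \<open>The diagonal term of the recurrence, moved to the right-hand side.\<close>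
  define D where "D = (\<lambda>k::int. - (h2 + z1 * of_int k * (of_int (k - int m2) + dl)
          + z2 * of_int (int n2 - k) * (of_int (int n2 - k - int m1) + dl)))"
  have "of_nat n1 + of_nat n2 = of_nat m1 + (of_nat m2 :: complex)" using n by (metis of_nat_add)
  then have n1: "of_nat n1 = of_nat m1 + of_nat m2 - (of_nat n2 :: complex)" by (simp add: algebra_simps)
  have n1': "int n1 = int m1 + int m2 - int n2" using n by linarith
  define R where "R = tridiag m1 m2 z1 z2 n2 dl h2"
  have Rc: "R c' k = 0" if "k \<in> {0..int n2}" for k
    using h1(2) z that tridiag_coefficients unfolding R_def h2_def p2 by blast
  define d'' where "d'' = (\<lambda>i. d' (int m2 - i) * (z1 / z2) powi i)"
  have Rd: "R d'' k = 0" if k: "k \<in> {int n2 - int m1..int m2}" for k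
  proof -
    have "tridiag m1 m2 z1 z2 n1 (- dl) h1 d' (int m2 - k) = 0"
      using h1(1) z k n1' unfolding p1 by (intro tridiag_coefficients) auto
    then show ?thesis unfolding R_def h2_def N_def d''_def tridiag_reflect[OF z(1,2) n] by simp
  qed
  have Re: "R e' k = 0" if k: "k \<in> {0..int m2}" for k
  proof -
    have "z1 * of_int (k * (int n1 - int m2 + k)) * e' (k - 1)
       + z2 * of_int ((int m2 - k) * (int n2 - k)) * e' (k + 1) = D k * e' k"
      by (rule difference_equation_recurrence[OF l q2 de2 _ k])
        (simp add: D_def dual_coeff_def h_def h2_def N_def dl_def n1 algebra_simps)
    then show ?thesis unfolding R_def tridiag_def D_def n1' by (simp add: algebra_simps)
  qed
  define f'' where "f'' = (\<lambda>i. f' (int n2 - i))"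
  have Rf: "R f'' i = 0" if i: "i \<in> {int n2 - int m1..int n2}" for i
  proof -
    define k where "k = int n2 - i"
    have k: "k \<in> {0..int m1}" using i by (auto simp: k_def)
    have "z2 * of_int (k * (int n1 - int m1 + k)) * f' (k - 1)
       + z1 * of_int ((int m1 - k) * (int n2 - k)) * f' (k + 1) = D (int n2 - k) * f' k"
      by (rule difference_equation_recurrence[OF l q1 de1 _ k])
        (simp add: D_def dual_coeff_def h_def h2_def N_def dl_def n1 algebra_simps)
    moreover have s: "f'' (i - 1) = f' (k + 1)" "f'' (i + 1) = f' (k - 1)" "f'' i = f' k" and i: "i = int n2 - k"
      by (simp_all add: f''_def k_def algebra_simps)
    ultimately show ?thesis unfolding R_def tridiag_def s D_def n1' unfolding i by (simp add: algebra_simps)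
  qed
  \<comment> \<open>The ranges of \<open>c'\<close> and of \<open>d''\<close>: there every solution comes from a polynomial solution, hence from a
    multiple of \<open>p2\<close> or of \<open>p1\<close>.\<close>
  have endC: "s i = 0" if "\<And>k. k \<in> {0..int n2} \<Longrightarrow> R s k = 0" "s 0 = 0 \<or> s (int n2) = 0" "i \<in> {0..int n2}" for s i
    by (rule heun_solution_end_zero[OF h1(2) pz(3,4) z(3) dl(1)]) (use that in \<open>auto simp: R_def h2_def\<close>)
  have endD: "s i = 0" if s: "\<And>k. k \<in> {int n2 - int m1..int m2} \<Longrightarrow> R s k = 0"
    and e: "s (int n2 - int m1) = 0 \<or> s (int m2) = 0" and i: "i \<in> {int n2 - int m1..int m2}" for s i
  proof -
    define t where "t = (\<lambda>k. s (int m2 - k) * (z1 / z2) powi k)"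
    \<comment> \<open>Reflecting back uses the same formula with the roles of \<open>n1\<close> and \<open>n2\<close> exchanged.\<close>
    have "tridiag m1 m2 z1 z2 n1 (- dl) (h2 - - dl * (of_nat m1 * z2 + of_nat m2 * z1)) t k =
        (z1 / z2) powi k * tridiag m1 m2 z1 z2 n2 (- (- dl)) h2 s (int m2 - k)" for k
      unfolding t_def using n by (intro tridiag_reflect[OF z(1,2)]) simp
    then have t: "tridiag m1 m2 z1 z2 n1 (- dl) h1 t k = (z1 / z2) powi k * R s (int m2 - k)" for k
      by (simp add: h2_def R_def N_def)
    have "t (int m2 - i) = 0"
    proof (rule heun_solution_end_zero[OF h1(1) pz(1,2) z(3) dl(2)])
      show "tridiag m1 m2 z1 z2 n1 (- dl) h1 t k = 0" if "k \<in> {0..int n1}" for k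
        unfolding t using s[of "int m2 - k"] that n1' by auto
      have "int m2 - int n1 = int n2 - int m1" using n1' by simp
      then show "t 0 = 0 \<or> t (int n1) = 0" using e by (auto simp: t_def)
      show "int m2 - i \<in> {0..int n1}" using i n1' by auto
    qed
    then show ?thesis using z by (simp add: t_def)
  qed
  define \<alpha> where "\<alpha> = max 0 (int n2 - int m1)"
  define \<beta> where "\<beta> = min (int n2) (int m2)"
  \<comment> \<open>The four sequences live on ranges \<open>{lo..hi}\<close> with these four combinations of ends.\<close>
  have nz: "s \<alpha> \<noteq> 0" if "\<And>i. i \<in> {lo..hi} \<Longrightarrow> R s i = 0" "lo = 0 \<or> lo = int n2 - int m1"
    "hi = int n2 \<or> hi = int m2" "i \<in> {lo..hi}" "s i \<noteq> 0" for s lo hi i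
  proof
    assume "s \<alpha> = 0"
    moreover have "n2 \<le> m1 + m2" using n by simp
    ultimately have "s i = 0" using tridiag_vanish[OF z(2), of n2 m1 m2 z1 dl h2 lo hi s i] that endC endD
      unfolding R_def \<alpha>_def by blast
    then show False using \<open>s i \<noteq> 0\<close> by simp
  qed
  have "\<exists>i\<le>n2. c' (int i) \<noteq> 0"
    using \<open>p2 \<noteq> 0\<close> unfolding p2 binary_form_def by (metis (no_types, lifting) atMost_iff smult_0_left sum.neutral)
  then obtain i where i: "i \<le> n2" "c' (int i) \<noteq> 0" by blast
  then have c0: "c' \<alpha> \<noteq> 0" using nz[of 0 "int n2" c' "int i"] Rc by auto
  have "\<exists>i\<le>n1. d' (int i) \<noteq> 0"
    using p0(1) unfolding p1 binary_form_def by (metis (no_types, lifting) atMost_iff poly_0 smult_0_left sum.neutral)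
  then obtain i where i: "i \<le> n1" "d' (int i) \<noteq> 0" by blast
  then have "d'' (int m2 - int i) \<noteq> 0" using z by (simp add: d''_def)
  then have d0: "d'' \<alpha> \<noteq> 0" using nz[of "int n2 - int m1" "int m2" d'' "int m2 - int i"] Rd i n1' by auto
  have "\<exists>i\<le>m2. e' (int i) \<noteq> 0"
  proof (rule ccontr)
    assume "\<not> ?thesis"
    then have "poly q2 u = 0" for u unfolding q2 by (intro sum.neutral) auto
    then show False using q(2) by (metis poly_all_0_iff_0)
  qed
  then obtain i where i: "i \<le> m2" "e' (int i) \<noteq> 0" by blast
  then have e0: "e' \<alpha> \<noteq> 0" using nz[of 0 "int m2" e' "int i"] Re by auto
  have "\<exists>i\<le>m1. f' (int i) \<noteq> 0"
  proof (rule ccontr)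
    assume "\<not> ?thesis"
    then have "poly q1 u = 0" for u unfolding q1 by (intro sum.neutral) auto
    then show False using q(1) by (metis poly_all_0_iff_0)
  qed
  then obtain i where i: "i \<le> m1" "f' (int i) \<noteq> 0" by blast
  then have "f'' (int n2 - int i) \<noteq> 0" by (simp add: f''_def)
  then have f0: "f'' \<alpha> \<noteq> 0" using nz[of "int n2 - int m1" "int n2" f'' "int n2 - int i"] Rf i by auto
  have proportional: "c' i = c' \<alpha> / s \<alpha> * s i" if s: "\<And>i. i \<in> {\<alpha>..\<beta>} \<Longrightarrow> R s i = 0" and "s \<alpha> \<noteq> 0" and i: "i \<in> {\<alpha>..\<beta>}" for s i
  proof -
    define t where "t = (\<lambda>i. s \<alpha> * c' i - c' \<alpha> * s i)"
    have "R t i = 0" if "i \<in> {\<alpha>..\<beta>}" for i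
      using that s[OF that] Rc[of i] unfolding R_def t_def tridiag_linear by (simp add: \<alpha>_def \<beta>_def)
    moreover have "t \<alpha> = 0" by (simp add: t_def)
    ultimately have "t i = 0"
      using tridiag_core[OF z(2), of n2 m1 m2 z1 dl h2 t i] i \<open>t \<alpha> = 0\<close> unfolding R_def \<alpha>_def \<beta>_def
      by blast
    then show ?thesis using \<open>s \<alpha> \<noteq> 0\<close> by (simp add: t_def field_simps)
  qed
  show ?thesis
  proof (intro exI conjI ballI)
    show "c' \<alpha> / d'' \<alpha> \<noteq> 0" "c' \<alpha> / e' \<alpha> \<noteq> 0" "c' \<alpha> / f'' \<alpha> \<noteq> 0" using c0 d0 e0 f0 by auto
    fix i assume "i \<in> {max 0 (n2 - m1)..min m2 n2}"
    then have i: "int i \<in> {\<alpha>..\<beta>}" "i \<le> m2" "i \<le> n2" by (auto simp: \<alpha>_def \<beta>_def)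
    have sub: "nat (int m2 - int i) = m2 - i" "nat (int n2 - int i) = n2 - i" by auto
    show "c i = c' \<alpha> / d'' \<alpha> * d (m2 - i) * (z1 / z2) ^ i"
      using proportional[of d'' "int i"] Rd d0 i sub by (simp add: \<alpha>_def \<beta>_def d''_def d'_def c'_def)
    show "c i = c' \<alpha> / e' \<alpha> * e i"
      using proportional[of e' "int i"] Re e0 i by (simp add: \<alpha>_def \<beta>_def e'_def c'_def)
    show "c i = c' \<alpha> / f'' \<alpha> * f (n2 - i)"
      using proportional[of f'' "int i"] Rf f0 i sub by (simp add: \<alpha>_def \<beta>_def f''_def f'_def c'_def)
  qed
qed

end
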